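(* Let $X$ be a finite connected $(k+1)$-regular graph (every vertex has valency $k+1$), with $k>1$. Then among the normalized length distances $d\in\Delta(X)$ on $X$, the volume entropy $h_{\mathrm{vol}}(d)$ is minimized exactly when the lengths of the edges are all equal, and the minimal volume entropy is $\frac{|EX|}{2}\log k$.
   Context: Graphs: $VX$ is the set of vertices of $X$ and $EX$ the set of oriented edges (so $|EX|$ is twice the number of unoriented edges); each $e\in EX$ has an initial vertex $i(e)$, a terminal vertex $t(e)$ and a reversed edge $\bar e\neq e$ with $\bar{\bar e}=e$, $i(\bar e)=t(e)$; an unoriented edge is a pair $\{e,\bar e\}$. Loops and multiple edges are allowed. The valency of $x$ is the number of $e\in EX$ with $i(e)=x$. The geometric realization is also denoted $X$. Length distances: given positive reals $\ell(e)=\ell(\bar e)$ for $e\in EX$, the length distance $d=d_\ell$ on $X$ is the maximal distance which makes each half-edge of an edge $e$ containing a vertex isometric to $[0,\ell(e)/2]$ (so each edge $e$ has length $\ell(e)$ and $d_\ell$ is the path metric). The volume is $\mathrm{vol}(X,d_\ell)=\frac12\sum_{e\in EX}\ell(e)$. $\Delta(X)$ denotes the set of all length distances $d=d_\ell$ on $X$ normalized so that $\mathrm{vol}(X,d)=1$. Volume entropy: let $\tilde X\to X$ be a universal covering tree with the lifted distance. For a connected subset $S\subset\tilde X$, $\ell(S)$ is the sum of the lengths of the (maximal pieces of) edges in $S$. Then $h_{\mathrm{vol}}(d)=\limsup_{r\to\infty}\frac1r\log \ell(B(x_0,r))$, where $B(x_0,r)$ is the ball of radius $r$ centered at a fixed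 vertex $x_0$ of $\tilde X$ (this is independent of $x_0$). *)

theory Defs
  imports "HOL-Analysis.Analysis" "Graph_Theory.Graph_Theory"
begin

text \<open>
  A graph in the sense of Serre (oriented edges, a fixed-point-free reversal, loops and
  multiple edges allowed) is a \<^locale>\<open>bidirected_digraph\<close>: the arcs are the oriented edges
  and \<open>arev\<close> is the reversal, extended by the identity outside the set of arcs.
\<close>

text \<open>
  In a bidirected digraph the round trip along a single edge is a \<^const>\<open>pre_digraph.cycle\<close>,
  so \<^const>\<open>forest\<close> and \<^const>\<open>tree\<close> of the digraph library are not the right notions here.
  Any other cycle is a circuit of the underlying unoriented graph.
\<close>

definition bidirected_tree :: "('a, 'b) pre_digraph \<Rightarrow> ('b \<Rightarrow> 'b) \<Rightarrow> bool" where
  "bidirected_tree T trev \<longleftrightarrow>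
     bidirected_digraph T trev \<and> connected T \<and>
     (\<forall>p. pre_digraph.cycle T p \<longrightarrow> (\<exists>e. p = [e, trev e]))"

definition graph_covering ::
  "('c, 'd) pre_digraph \<Rightarrow> ('d \<Rightarrow> 'd) \<Rightarrow> ('a, 'b) pre_digraph \<Rightarrow> ('b \<Rightarrow> 'b) \<Rightarrow>
   ('c \<Rightarrow> 'a) \<Rightarrow> ('d \<Rightarrow> 'b) \<Rightarrow> bool" where
  "graph_covering T trev X xrev pV pE \<longleftrightarrow>
     bidirected_digraph T trev \<and> bidirected_digraph X xrev \<and>
     pV ` verts T = verts X \<and>
     (\<forall>e\<in>arcs T. pE e \<in> arcs X \<and> tail X (pE e) = pV (tail T e) \<and>
                 head X (pE e) = pV (head T e) \<and> pE (trev e) = xrev (pE e)) \<and>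
     (\<forall>v\<in>verts T. bij_betw pE (out_arcs T v) (out_arcs X (pV v)))"

definition universal_covering_tree ::
  "('c, 'd) pre_digraph \<Rightarrow> ('d \<Rightarrow> 'd) \<Rightarrow> ('a, 'b) pre_digraph \<Rightarrow> ('b \<Rightarrow> 'b) \<Rightarrow>
   ('c \<Rightarrow> 'a) \<Rightarrow> ('d \<Rightarrow> 'b) \<Rightarrow> bool" where
  "universal_covering_tree T trev X xrev pV pE \<longleftrightarrow>
     bidirected_tree T trev \<and> graph_covering T trev X xrev pV pE"

text \<open>
  A length distance is represented by its edge lengths, which determine it (it is the path
  metric) and which it determines (the length of an edge is twice that of its half-edges).
  The values of \<open>l\<close> outside the set of arcs are irrelevant.
\<close>

definition edge_lengths :: "('a, 'b) pre_digraph \<Rightarrow> ('b \<Rightarrow> 'b) \<Rightarrow> ('b \<Rightarrow> real) set" where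
  "edge_lengths X xrev = {l. \<forall>e\<in>arcs X. 0 < l e \<and> l (xrev e) = l e}"

definition volume :: "('a, 'b) pre_digraph \<Rightarrow> ('b \<Rightarrow> real) \<Rightarrow> real" where
  "volume X l = (\<Sum>e\<in>arcs X. l e) / 2"

definition normalized_lengths :: "('a, 'b) pre_digraph \<Rightarrow> ('b \<Rightarrow> 'b) \<Rightarrow> ('b \<Rightarrow> real) set" where
  "normalized_lengths X xrev = {l \<in> edge_lengths X xrev. volume X l = 1}"

text \<open>
  Path distance in the geometric realization from the vertex \<open>x\<close> to the point of the edge \<open>e\<close>
  at distance \<open>s\<close> from the initial vertex along \<open>e\<close>, where \<open>0 \<le> s \<le> l e\<close>: a path reaches this
  point through one of the two ends of \<open>e\<close>. Distances between vertices are given by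
  \<^const>\<open>wf_digraph.\<mu>\<close>, the infimum of the lengths of the walks joining them.
\<close>

definition point_dist ::
  "('a, 'b) pre_digraph \<Rightarrow> ('b \<Rightarrow> real) \<Rightarrow> 'a \<Rightarrow> 'b \<Rightarrow> real \<Rightarrow> ereal" where
  "point_dist T l x e s =
     min (wf_digraph.\<mu> T l x (tail T e) + ereal s)
         (wf_digraph.\<mu> T l x (head T e) + ereal (l e - s))"

text \<open>
  Total length of the pieces of edges inside the open ball of radius \<open>r\<close> about \<open>x\<close>; every
  unoriented edge is counted twice in the sum, hence the division by 2. For a covering tree of
  a finite graph, with lifted lengths, only finitely many summands are nonzero. Using the
  closed ball would give the same value.
\<close>

definition ball_length :: "('a, 'b) pre_digraph \<Rightarrow> ('b \<Rightarrow> real) \<Rightarrow> 'a \<Rightarrow> real \<Rightarrow> real" where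
  "ball_length T l x r =
     (\<Sum>\<^sub>\<infinity>e\<in>arcs T. measure lborel {s \<in> {0..l e}. point_dist T l x e s < ereal r}) / 2"

text \<open>
  Volume entropy of the length distance with edge lengths \<open>l\<close> on the base graph, computed in
  the covering tree \<open>T\<close> with the lifted edge lengths \<open>l \<circ> pE\<close>.
\<close>

definition volume_entropy ::
  "('c, 'd) pre_digraph \<Rightarrow> ('d \<Rightarrow> 'b) \<Rightarrow> 'c \<Rightarrow> ('b \<Rightarrow> real) \<Rightarrow> ereal" where
  "volume_entropy T pE x\<^sub>0 l =
     Limsup at_top (\<lambda>r. ereal (1 / r * ln (ball_length T (l \<circ> pE) x\<^sub>0 r)))"

text \<open>
  Every connected graph has a universal covering tree: its vertices are the reduced paths
  starting at a base vertex.
\<close>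

context bidirected_digraph
begin

fun reduced :: "'b list \<Rightarrow> bool" where
  "reduced [] \<longleftrightarrow> True"
| "reduced [e] \<longleftrightarrow> True"
| "reduced (e # f # p) \<longleftrightarrow> f \<noteq> arev e \<and> reduced (f # p)"

lemma reduced_snoc: "reduced (p @ [a]) \<longleftrightarrow> reduced p \<and> (p = [] \<or> a \<noteq> arev (last p))"
  by (induction p rule: reduced.induct) auto

definition path_end :: "'a \<Rightarrow> 'b list \<Rightarrow> 'a" where
  "path_end v p = (if p = [] then v else head G (last p))"

definition path_verts :: "'a \<Rightarrow> 'b list set" where
  "path_verts v = {p. awalk v p (path_end v p) \<and> reduced p}"

definition path_head :: "'b list \<times> 'b \<Rightarrow> 'b list" where
  "path_head = (\<lambda>(p, a). if p \<noteq> [] \<and> a = arev (last p) then butlast p else p @ [a])"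

definition path_arcs :: "'a \<Rightarrow> ('b list \<times> 'b) set" where
  "path_arcs v = {(p, a). p \<in> path_verts v \<and> a \<in> arcs G \<and> tail G a = path_end v p}"

definition path_rev :: "'a \<Rightarrow> 'b list \<times> 'b \<Rightarrow> 'b list \<times> 'b" where
  "path_rev v e = (if e \<in> path_arcs v then (path_head e, arev (snd e)) else e)"

definition path_tree :: "'a \<Rightarrow> ('b list, 'b list \<times> 'b) pre_digraph" where
  "path_tree v = \<lparr>verts = path_verts v, arcs = path_arcs v, tail = fst, head = path_head\<rparr>"

lemma path_tree_sel:
  "verts (path_tree v) = path_verts v" "arcs (path_tree v) = path_arcs v"
  "tail (path_tree v) = fst" "head (path_tree v) = path_head"
  by (simp_all add: path_tree_def)

lemma awalk_snoc: "awalk u (p @ [a]) w \<longleftrightarrow> awalk u p (tail G a) \<and> a \<in> arcs G \<and> w = head G a"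
  by (auto simp: awalk_append_iff awalk_Cons_iff awalk_Nil_iff)

lemma path_verts_snoc: "p @ [a] \<in> path_verts v \<longleftrightarrow>
    p \<in> path_verts v \<and> a \<in> arcs G \<and> tail G a = path_end v p \<and> (p = [] \<or> a \<noteq> arev (last p))"
proof -
  have "awalk v p (tail G a) \<Longrightarrow> tail G a = path_end v p"
    by (cases p rule: rev_cases) (auto simp: awalk_snoc path_end_def awalk_Nil_iff)
  moreover have "path_end v (p @ [a]) = head G a" by (simp add: path_end_def)
  ultimately show ?thesis
    unfolding path_verts_def mem_Collect_eq reduced_snoc awalk_snoc by metis
qed

lemma path_arcs_cases:
  assumes "e \<in> path_arcs v"
  obtains (forward) p a where "e = (p, a)" "path_head e = p @ [a]" "p @ [a] \<in> path_verts v"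
      "p \<in> path_verts v" "a \<in> arcs G" "tail G a = path_end v p" "p = [] \<or> a \<noteq> arev (last p)"
  | (backward) p b where "e = (p @ [b], arev b)" "path_head e = p" "p @ [b] \<in> path_verts v"
      "p \<in> path_verts v" "b \<in> arcs G" "tail G b = path_end v p" "p = [] \<or> b \<noteq> arev (last p)"
proof (cases "fst e \<noteq> [] \<and> snd e = arev (last (fst e))")
  case True
  then have "e = (butlast (fst e) @ [last (fst e)], arev (last (fst e)))" by (simp add: prod_eq_iff)
  moreover have "path_head e = butlast (fst e)" using True by (cases e) (simp add: path_head_def)
  moreover have "butlast (fst e) @ [last (fst e)] \<in> path_verts v"
    using True assms by (auto simp: path_arcs_def)
  ultimately show thesis using backward path_verts_snoc by metis
next
  case False
  then have "path_head e = fst e @ [snd e]" by (cases e) (auto simp: path_head_def)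
  moreover have "fst e @ [snd e] \<in> path_verts v"
    using False assms by (auto simp: path_arcs_def path_verts_snoc)
  ultimately show thesis using forward[of "fst e" "snd e"] path_verts_snoc by simp
qed

lemma path_head_in: "e \<in> path_arcs v \<Longrightarrow> path_head e \<in> path_verts v"
  by (erule path_arcs_cases) auto

lemma path_end_head: "e \<in> path_arcs v \<Longrightarrow> path_end v (path_head e) = head G (snd e)"
  by (erule path_arcs_cases) (auto simp: path_end_def)

lemma path_rev_rev: "e \<in> path_arcs v \<Longrightarrow> path_head (path_head e, arev (snd e)) = fst e"
  by (erule path_arcs_cases) (auto simp: path_head_def)

lemma path_rev_in: "e \<in> path_arcs v \<Longrightarrow> path_rev v e \<in> path_arcs v"
  using path_head_in[of e v] path_end_head[of e v]
  by (auto simp: path_rev_def path_arcs_def)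

lemma bidirected_path_tree: "bidirected_digraph (path_tree v) (path_rev v)"
proof -
  have wf: "wf_digraph (path_tree v)"
    by unfold_locales (use path_head_in in \<open>auto simp: path_tree_sel path_arcs_def\<close>)
  have neq: "path_rev v e \<noteq> e" if "e \<in> path_arcs v" for e
    using that arev_neq by (cases e) (auto simp: path_rev_def path_arcs_def)
  have "path_rev v (path_rev v e) = e" if "e \<in> path_arcs v" for e
    using that path_rev_in[OF that] path_rev_rev[OF that] by (cases e) (auto simp: path_rev_def)
  then show ?thesis
    using wf neq by (intro wf_digraph.bidirected_digraphI)
      (auto simp: path_tree_sel path_rev_def)
qed

lemma covering_path_tree:
  assumes "connected G" "v \<in> verts G"
  shows "graph_covering (path_tree v) (path_rev v) G arev (path_end v) snd"
proof -
  have "w \<in> path_end v ` path_verts v" if "w \<in> verts G" for w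
  proof -
    have "v \<rightarrow>\<^sup>*\<^bsub>G\<^esub> w"
      using symmetric_connected_imp_strongly_connected[OF sym_arcs assms(1)] assms(2) that by auto
    then obtain p where "awalk v p w" by (auto simp: reachable_awalk)
    then show ?thesis
    proof (induction "length p" arbitrary: p w rule: less_induct)
      case less
      show ?case
      proof (cases p rule: rev_cases)
        case Nil
        then show ?thesis using less.prems by (intro image_eqI[of _ _ "[]"])
          (auto simp: path_verts_def path_end_def awalk_Nil_iff)
      next
        case (snoc q a)
        with less.prems have aw: "awalk v q (tail G a)" "a \<in> arcs G" "w = head G a"
          by (simp_all add: awalk_snoc del: awalk_append_iff)
        have "tail G a \<in> path_end v ` path_verts v" using less.hyps[OF _ aw(1)] snoc by simp
        then obtain r where r: "r \<in> path_verts v" "tail G a = path_end v r" by auto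
        with aw have "(r, a) \<in> path_arcs v" by (auto simp: path_arcs_def)
        from path_head_in[OF this] path_end_head[OF this] show ?thesis
          using aw(3) by (auto intro!: image_eqI)
      qed
    qed
  qed
  moreover have "path_end v ` path_verts v \<subseteq> verts G"
    by (auto simp: path_verts_def)
  moreover have "bij_betw snd (out_arcs (path_tree v) p) (out_arcs G (path_end v p))"
    if "p \<in> path_verts v" for p
    using that by (intro bij_betwI[where g = "\<lambda>a. (p, a)"])
      (auto simp: path_tree_sel path_arcs_def out_arcs_def)
  ultimately show ?thesis
    unfolding graph_covering_def
    using bidirected_path_tree[of v] bidirected_digraph path_end_head[of _ v]
    by (auto simp: path_tree_sel path_rev_def path_arcs_def)
qed

definition forward :: "'b list \<times> 'b \<Rightarrow> bool" where
  "forward e \<longleftrightarrow> path_head e = fst e @ [snd e]"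

lemma path_forward_step: "e \<in> path_arcs v \<Longrightarrow> \<not> forward e \<Longrightarrow>
    fst e \<noteq> [] \<and> snd e = arev (last (fst e)) \<and> path_head e = butlast (fst e)"
  by (cases e) (auto simp: forward_def path_head_def split: if_splits)

lemma forward_walk:
  assumes "pre_digraph.cas (path_tree v) p es q" "set es \<subseteq> path_arcs v"
    "es \<noteq> []" "forward (hd es)"
    "\<And>i. Suc i < length es \<Longrightarrow> es ! Suc i \<noteq> path_rev v (es ! i)"
  shows "q = p @ map snd es \<and> (\<forall>e\<in>set es. forward e)"
  using assms
proof (induction es arbitrary: p)
  case (Cons e es)
  have e: "fst e = p" "path_head e = p @ [snd e]" "e \<in> path_arcs v"
    and c: "pre_digraph.cas (path_tree v) (path_head e) es q"
    using Cons.prems by (auto simp: path_tree_sel pre_digraph.cas.simps forward_def)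
  show ?case
  proof (cases es)
    case Nil
    then show ?thesis using c e Cons.prems by (auto simp: pre_digraph.cas.simps)
  next
    case (Cons f fs)
    have f: "fst f = p @ [snd e]" "f \<in> path_arcs v"
      using c Cons Cons.prems e by (auto simp: pre_digraph.cas.simps path_tree_sel)
    have "f \<noteq> path_rev v e" using Cons.prems(5)[of 0] Cons by auto
    then have "forward f"
      using path_forward_step[OF f(2)] f e by (cases f) (auto simp: path_rev_def)
    moreover have "\<And>i. Suc i < length es \<Longrightarrow> es ! Suc i \<noteq> path_rev v (es ! i)"
      using Cons.prems(5)[of "Suc _"] by auto
    ultimately have "q = path_head e @ map snd es \<and> (\<forall>e\<in>set es. forward e)"
      using Cons.prems c Cons by (intro Cons.IH) auto
    then show ?thesis using e Cons.prems by auto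
  qed
qed simp

lemma backward_walk:
  assumes "pre_digraph.cas (path_tree v) p es q" "set es \<subseteq> path_arcs v" "\<forall>e\<in>set es. \<not> forward e"
  shows "length p = length q + length es"
  using assms
proof (induction es arbitrary: p)
  case (Cons e es)
  have "e \<in> path_arcs v" "\<not> forward e" "fst e = p"
    and c: "pre_digraph.cas (path_tree v) (path_head e) es q"
    using Cons.prems by (auto simp: path_tree_sel pre_digraph.cas.simps)
  with path_forward_step[of e v] have "p \<noteq> []" "path_head e = butlast p" by auto
  then show ?case using Cons.IH[OF c] Cons.prems(2,3) by (cases p) (auto split: if_splits)
qed (simp add: pre_digraph.cas.simps)

lemma tree_path_tree:
  assumes "v \<in> verts G"
  shows "bidirected_tree (path_tree v) (path_rev v)"
proof -
  interpret T: bidirected_digraph "path_tree v" "path_rev v" by (rule bidirected_path_tree)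
  have Nil: "[] \<in> path_verts v" using assms by (auto simp: path_verts_def path_end_def awalk_Nil_iff)
  have reach: "[] \<rightarrow>\<^sup>*\<^bsub>path_tree v\<^esub> p" if "p \<in> path_verts v" for p
    using that
  proof (induction p rule: rev_induct)
    case Nil then show ?case by (intro T.reachable_refl) (simp add: path_tree_sel)
  next
    case (snoc a p)
    then have *: "p \<in> path_verts v" "(p, a) \<in> path_arcs v" "path_head (p, a) = p @ [a]"
      by (auto simp: path_verts_snoc path_arcs_def path_head_def)
    then have "p \<rightarrow>\<^bsub>path_tree v\<^esub> (p @ [a])"
      by (auto simp: arcs_ends_conv path_tree_sel intro!: image_eqI[of _ _ "(p, a)"])
    with snoc * show ?case by (meson T.adj_in_verts T.reachable_adj_trans)
  qed
  have "connected (path_tree v)"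
    unfolding connected_def strongly_connected_def
  proof (intro conjI ballI)
    show "verts (mk_symmetric (path_tree v)) \<noteq> {}"
      using Nil by (auto simp: path_tree_sel)
    fix p q assume "p \<in> verts (mk_symmetric (path_tree v))" "q \<in> verts (mk_symmetric (path_tree v))"
    then have "p \<in> path_verts v" "q \<in> path_verts v" by (auto simp: path_tree_sel)
    then have "p \<rightarrow>\<^sup>*\<^bsub>path_tree v\<^esub> q"
      by (rule T.reachable_trans[OF T.symmetric_reachable'[OF reach] reach])
    then show "p \<rightarrow>\<^sup>*\<^bsub>mk_symmetric (path_tree v)\<^esub> q" by (rule T.reachable_mk_symmetricI)
  qed
  moreover have "\<exists>e. c = [e, path_rev v e]" if cyc: "T.cycle c" for c
  proof (rule ccontr)
    assume no: "\<nexists>e. c = [e, path_rev v e]"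
    obtain u where u: "T.awalk u c u" "distinct (tl (T.awalk_verts u c))" "c \<noteq> []"
      using cyc by (auto simp: T.cycle_def)
    then have cas: "T.cas u c u" and sub: "set c \<subseteq> path_arcs v"
      by (auto simp: T.awalk_def path_tree_sel)
    have dist: "distinct (map path_head c)"
      using u T.awalk_verts_conv'[OF cas] by (simp add: path_tree_sel)
    have inj: "i = j" if "path_head (c ! i) = path_head (c ! j)" "i < length c" "j < length c" for i j
      using dist that by (auto simp: distinct_conv_nth)
    have two: "c = [c ! 0, c ! 1]" if "length c = 2"
      using that by (auto simp: length_Suc_conv numeral_2_eq_2)
    have hin: "hd c \<in> path_arcs v" and lin: "last c \<in> path_arcs v" using sub u(3) by auto
    have lst: "path_head (last c) = u"
      using cas u(3) T.awlast_if_cas[OF cas] T.awalk_verts_conv[of u c] by (simp add: path_tree_sel)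
    have hd: "fst (hd c) = u"
      using cas u(3) by (cases c) (auto simp: path_tree_sel)
    have step: "fst (c ! Suc i) = path_head (c ! i)" if "Suc i < length c" for i
    proof -
      have "c = take i c @ c ! i # c ! Suc i # drop (Suc (Suc i)) c"
        using that by (simp add: Cons_nth_drop_Suc id_take_nth_drop[symmetric])
      with cas have "T.cas u (take i c @ c ! i # c ! Suc i # drop (Suc (Suc i)) c) u" by simp
      then show ?thesis unfolding T.cas_append_iff by (auto simp: path_tree_sel)
    qed
    have red: "c ! Suc i \<noteq> path_rev v (c ! i)" if i: "Suc i < length c" for i
    proof
      assume eq: "c ! Suc i = path_rev v (c ! i)"
      have "c ! i \<in> path_arcs v" using sub i by auto
      then have h: "path_head (c ! Suc i) = fst (c ! i)"
        using eq path_rev_rev by (auto simp: path_rev_def)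
      show False
      proof (cases i)
        case 0
        have "path_head (c ! Suc i) = u" using h hd 0 u(3) by (simp add: hd_conv_nth)
        then have "path_head (c ! Suc i) = path_head (c ! (length c - 1))"
          using lst u(3) by (simp add: last_conv_nth)
        then have "Suc i = length c - 1"
          using inj i by simp
        then have "c = [c ! 0, c ! 1]" using two 0 i by simp
        then show False using no eq 0 by (metis One_nat_def)
      next
        case (Suc j)
        then have "path_head (c ! Suc i) = path_head (c ! j)" using h step[of j] i by simp
        then show False using inj[of "Suc i" j] i Suc by simp
      qed
    qed
    show False
    proof (cases "forward (hd c)")
      case True
      from forward_walk[OF cas sub u(3) True red] u(3) show False by auto
    next
      case False
      show False
      proof (cases "\<forall>e\<in>set c. \<not> forward e")
        case True
        from backward_walk[OF cas sub True] u(3) show False by auto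
      next
        case nall: False
        then obtain i where i: "i < length c" "forward (c ! i)" by (auto simp: in_set_conv_nth)
        have "c = take i c @ drop i c" by simp
        with cas have "T.cas u (take i c @ drop i c) u" by simp
        then obtain w where w: "T.cas w (drop i c) u" unfolding T.cas_append_iff by auto
        have "\<forall>e\<in>set (drop i c). forward e"
          using forward_walk[OF w] sub i red[of "i + _"] set_drop_subset[of i c]
          by (auto simp: hd_drop_conv_nth)
        then have fl: "forward (last c)" using i by (metis drop_eq_Nil last_drop last_in_set leD)
        have ul: "u = fst (last c) @ [snd (last c)]" using fl lst by (simp add: forward_def)
        have hu: "path_head (hd c) = butlast u" "snd (hd c) = arev (last u)"
          using path_forward_step[OF hin False] hd by auto
        have eq: "path_head (c ! 0) = fst (last c)" using hu ul u(3) by (simp add: hd_conv_nth)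
        show False
        proof (cases "length c = 1")
          case True
          then have "last c = hd c" by (cases c) auto
          then show False using False fl by simp
        next
          case len: False
          define n where "n = length c - 2"
          have n: "length c = Suc (Suc n)" using len u(3) by (cases c rule: rev_cases) (auto simp: n_def neq_Nil_conv)
          have "path_head (c ! 0) = path_head (c ! n)"
            using eq step[of n] n u(3) by (simp add: last_conv_nth)
          then have "n = 0" using inj[of 0 n] n by simp
          then have "c = [c ! 0, c ! 1]" using two n by simp
          moreover have "last c = path_rev v (hd c)"
            using hu ul hin by (auto simp: path_rev_def prod_eq_iff)
          ultimately show False using no by (metis last_ConsL last_ConsR list.sel(1) list.distinct(1))
        qed
      qed
    qed
  qed
  ultimately show ?thesis
    unfolding bidirected_tree_def using bidirected_path_tree by blast
qed

theorem universal_covering_tree_exists: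
  assumes "connected G" "v \<in> verts G"
  shows "universal_covering_tree (path_tree v) (path_rev v) G arev (path_end v) snd"
  using tree_path_tree[OF assms(2)] covering_path_tree[OF assms]
  by (simp add: universal_covering_tree_def)

end

end

theory Submission
  imports Defs
begin

text \<open>
  Let \<open>n\<close> be the number of oriented edges and \<open>h\<^sub>0 = n / 2 \<cdot> ln k\<close>. If \<open>h\<close> exceeds the volume
  entropy of \<open>l\<close>, then the sum of \<open>exp (- h \<cdot> length)\<close> over all walks without backtracking that
  start at \<open>x\<^sub>0\<close> converges, because distinct such walks in a tree have distinct last arcs and so
  are counted by the volume of balls. Splitting off the part of a walk after an arc \<open>e\<close> gives
  positive weights \<open>u e\<close> on the oriented edges of the finite graph with
  \<open>(\<Sum>f. exp (- h \<cdot> l f) \<cdot> u f) \<le> u e\<close>, where \<open>f\<close> runs over the \<open>k\<close> arcs that may follow \<open>e\<close>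
  (\<open>subinvariant_of_entropy_less\<close>). Every arc gets a weight, as in a regular finite graph
  of valency at least 3 every arc can be reached without backtracking (\<open>forward_closed_eq_arcs\<close>).

  Put \<open>z e f = ln k - h \<cdot> l f + ln (u f) - ln (u e)\<close>. The inequality for \<open>u\<close> says that the mean of
  \<open>exp (z e f)\<close> over \<open>f\<close> is at most 1. Every arc follows exactly \<open>k\<close> arcs, so the terms in \<open>u\<close>
  cancel from the sum of \<open>z e f\<close> over all pairs, which for volume 1 equals \<open>- 2 k (h - h\<^sub>0)\<close>.
  Therefore the nonnegative numbers \<open>exp (z e f) - 1 - z e f\<close> have sum at most
  \<open>2 k (h - h\<^sub>0)\<close> (\<open>sum_exp_defect_le\<close>). This forces \<open>h \<ge> h\<^sub>0\<close>, which is the lower bound for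
  the entropy. If the entropy is \<open>h\<^sub>0\<close>, then \<open>h\<close> may tend to \<open>h\<^sub>0\<close> and all \<open>z e f\<close> tend to 0.
  The weights can be eliminated locally, by comparing three arcs at a vertex and using
  that an edge and its reverse have the same length (\<open>scaled_length_near_log_k\<close>), and this
  leaves \<open>h\<^sub>0 \<cdot> l a = ln k\<close> for every arc \<open>a\<close>. So \<open>l\<close> is constant.

  Conversely, when all edges have the same length \<open>m\<close>, a ball of radius \<open>r\<close> meets only arcs at
  vertices at most \<open>r / m\<close> steps away, and there are \<open>O(k ^ (r / m))\<close> of these
  (\<open>ball_length_upper\<close>). Hence the entropy is at most \<open>ln k / m = h\<^sub>0\<close>.
\<close>

section \<open>Continuing walks without backtracking\<close>

context bidirected_digraph
begin

definition continuations :: "'b \<Rightarrow> 'b set" where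
  "continuations e = {f \<in> arcs G. tail G f = head G e \<and> f \<noteq> arev e}"

lemma continuations_iff:
  "f \<in> continuations e \<longleftrightarrow> f \<in> arcs G \<and> tail G f = head G e \<and> f \<noteq> arev e"
  by (simp add: continuations_def)

lemma continuations_eq_out_arcs:
  "continuations e = out_arcs G (head G e) - {arev e}"
  by (auto simp: continuations_def)

lemma predecessors_eq:
  assumes "f \<in> arcs G"
  shows "{e \<in> arcs G. f \<in> continuations e} = arev ` continuations (arev f)"
proof (intro equalityI subsetI)
  fix e assume "e \<in> {e \<in> arcs G. f \<in> continuations e}"
  then have "arev e \<in> continuations (arev f)" "e = arev (arev e)"
    using assms by (auto simp: continuations_iff arev_eq_iff)
  then show "e \<in> arev ` continuations (arev f)" by blast
next
  fix e assume "e \<in> arev ` continuations (arev f)"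
  then show "e \<in> {e \<in> arcs G. f \<in> continuations e}"
    using assms by (auto simp: continuations_iff)
qed

end

locale regular_graph = bidirected_digraph G arev
  for G :: "('a, 'b) pre_digraph" and arev +
  fixes k :: nat
  assumes k_gt_1: "k > 1"
    and out_degree_eq: "v \<in> verts G \<Longrightarrow> out_degree G v = k + 1"
begin

lemma card_out_arcs: "v \<in> verts G \<Longrightarrow> card (out_arcs G v) = k + 1"
  using out_degree_eq by (simp add: out_degree_def)

lemma finite_out_arcs_regular: "v \<in> verts G \<Longrightarrow> finite (out_arcs G v)"
  by (rule card_ge_0_finite) (simp add: card_out_arcs)

lemma finite_continuations: "e \<in> arcs G \<Longrightarrow> finite (continuations e)"
  by (simp add: continuations_eq_out_arcs finite_out_arcs_regular)

lemma card_continuations: "e \<in> arcs G \<Longrightarrow> card (continuations e) = k"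
  by (simp add: continuations_eq_out_arcs card_out_arcs card_Diff_singleton)

lemma card_predecessors: "f \<in> arcs G \<Longrightarrow> card {e \<in> arcs G. f \<in> continuations e} = k"
  by (simp add: predecessors_eq card_image inj_on_arev card_continuations)

text \<open>
  Each arc is a continuation of exactly \<open>k\<close> arcs, because reversal turns its predecessors into
  the continuations of its reverse. In other words, the uniform distribution on the arcs is
  stationary for the random walk without backtracking.
\<close>

lemma sum_continuations:
  fixes g :: "'b \<Rightarrow> real"
  assumes "finite (arcs G)"
  shows "(\<Sum>e\<in>arcs G. \<Sum>f\<in>continuations e. g f) = real k * (\<Sum>f\<in>arcs G. g f)"
proof -
  have "(\<Sum>e\<in>arcs G. \<Sum>f\<in>continuations e. g f) =
      (\<Sum>e\<in>arcs G. \<Sum>f | f \<in> arcs G \<and> f \<in> continuations e. g f)"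
    by (intro sum.cong refl) (auto simp: continuations_iff)
  also have "\<dots> = (\<Sum>f\<in>arcs G. \<Sum>e | e \<in> arcs G \<and> f \<in> continuations e. g f)"
    using assms by (intro sum.swap_restrict)
  also have "\<dots> = (\<Sum>f\<in>arcs G. real k * g f)"
    by (simp add: card_predecessors)
  finally show ?thesis by (simp add: sum_distrib_left)
qed

text \<open>
  Forward closed sets of a chain with uniform stationary distribution are also backward
  closed: the \<open>k \<cdot> card R\<close> steps that start in \<open>R\<close> already account for all steps that end
  in \<open>R\<close>, so none can enter from outside.
\<close>

lemma predecessor_in_forward_closed:
  assumes "finite (arcs G)" "R \<subseteq> arcs G"
    and closed: "\<And>e. e \<in> R \<Longrightarrow> continuations e \<subseteq> R"
    and "e \<in> arcs G" "f \<in> continuations e" "f \<in> R"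
  shows "e \<in> R"
proof (rule ccontr)
  assume "e \<notin> R"
  define g :: "'b \<Rightarrow> real" where "g = indicator R"
  define s where "s e = (\<Sum>f\<in>continuations e. g f)" for e
  have fin: "finite R" using assms finite_subset by blast
  have "s e = real k" if "e \<in> R" for e
  proof -
    have "s e = (\<Sum>f\<in>continuations e. 1)"
      unfolding s_def using closed[OF that] by (intro sum.cong) (auto simp: g_def)
    then show ?thesis using card_continuations that assms(2) by auto
  qed
  then have "sum s R = real k * card R" by simp
  also have "\<dots> = real k * sum g (arcs G)"
    using assms(1,2) by (simp add: g_def indicator_def sum.If_cases Int_absorb1)
  also have "\<dots> = sum s (arcs G)" unfolding s_def by (simp add: sum_continuations assms(1))
  also have "\<dots> = sum s (arcs G - R) + sum s R"
    using assms by (intro sum.subset_diff) auto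
  finally have "sum s (arcs G - R) = 0" by simp
  moreover have nonneg: "s e \<ge> 0" for e
    by (auto simp: s_def g_def intro: sum_nonneg)
  ultimately have "s e = 0"
    using assms \<open>e \<notin> R\<close> by (subst (asm) sum_nonneg_eq_0_iff) auto
  moreover have "s e \<ge> g f"
    unfolding s_def using assms finite_continuations by (intro member_le_sum) (auto simp: g_def)
  ultimately show False using \<open>f \<in> R\<close> by (simp add: g_def)
qed

text \<open>
  The walk without backtracking is irreducible. Once \<open>R\<close> has one arc into a vertex \<open>v\<close>, it has
  two different arcs out of \<open>v\<close>. Any arc into \<open>v\<close> precedes at least one of these two, so backward
  closure puts all arcs into \<open>v\<close>, and then all arcs out of \<open>v\<close>, in \<open>R\<close>. This property spreads
  along walks.
\<close>

lemma forward_closed_eq_arcs: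
  assumes "finite (arcs G)" "connected G" "R \<subseteq> arcs G" "R \<noteq> {}"
    and closed: "\<And>e. e \<in> R \<Longrightarrow> continuations e \<subseteq> R"
  shows "R = arcs G"
proof -
  note backward = predecessor_in_forward_closed[OF assms(1,3) closed]
  have star: "out_arcs G (head G e) \<subseteq> R" if "e \<in> R" for e
  proof
    fix g assume g: "g \<in> out_arcs G (head G e)"
    have e: "e \<in> arcs G" using that assms(3) by auto
    have "2 \<le> card (continuations e)" using card_continuations[OF e] k_gt_1 by simp
    then obtain f f' where f: "f \<in> continuations e" "f' \<in> continuations e" "f \<noteq> f'"
      by (auto simp: card_le_Suc_iff numeral_2_eq_2)
    then have fR: "f \<in> R" "f' \<in> R" using closed that by auto
    have fa: "f \<in> arcs G" "f' \<in> arcs G" "tail G f = head G e" "tail G f' = head G e"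
      using f by (auto simp: continuations_iff)
    have inc: "e' \<in> R" if e': "e' \<in> arcs G" "head G e' = head G e" for e'
    proof (cases "f = arev e'")
      case True
      then have "f' \<in> continuations e'" using f e' fa by (auto simp: continuations_iff)
      then show ?thesis using backward e' fR by blast
    next
      case False
      then have "f \<in> continuations e'" using e' fa by (auto simp: continuations_iff)
      then show ?thesis using backward e' fR by blast
    qed
    obtain b where b: "b \<in> arcs G" "tail G b = head G e" "b \<noteq> g"
      using f(3) fa by metis
    then have "g \<in> continuations (arev b)" using g by (auto simp: continuations_iff)
    moreover have "arev b \<in> R" using b inc by simp
    ultimately show "g \<in> R" using closed by auto
  qed
  obtain e where e: "e \<in> R" using assms by auto
  then have eG: "head G e \<in> verts G" using assms by auto
  have walk: "out_arcs G w \<subseteq> R" if "awalk u p w" "out_arcs G u \<subseteq> R" for u p w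
    using that
  proof (induction p arbitrary: u)
    case Nil then show ?case by (auto simp: awalk_Nil_iff)
  next
    case (Cons a p)
    then have "a \<in> out_arcs G u" "awalk (head G a) p w" by (auto simp: awalk_Cons_iff)
    then show ?case using Cons star by blast
  qed
  have "a \<in> R" if a: "a \<in> arcs G" for a
  proof -
    have "head G e \<rightarrow>\<^sup>*\<^bsub>G\<^esub> tail G a"
      using symmetric_connected_imp_strongly_connected[OF sym_arcs assms(2)] eG a by auto
    then obtain p where "awalk (head G e) p (tail G a)" by (auto simp: reachable_awalk)
    from walk[OF this star[OF e]] a show ?thesis by auto
  qed
  then show ?thesis using assms by blast
qed

end

section \<open>Subinvariant edge weights\<close>

text \<open>
  Squaring \<open>1 + z / 2 \<le> exp (z / 2)\<close> yields the quadratic bound \<open>z\<^sup>2 / 4 \<le> exp z - 1 - z\<close>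
  as long as \<open>z \<ge> - 2\<close>, and smaller \<open>z\<close> have a defect larger than 1.
\<close>

lemma abs_le_of_exp_defect:
  fixes z :: real
  assumes "exp z - 1 - z \<le> d" "d \<le> 1"
  shows "\<bar>z\<bar> \<le> 2 * sqrt d"
proof -
  have "- 1 - z < 1" using assms exp_gt_zero[of z] by linarith
  then have "0 \<le> 1 + z / 2" by simp
  then have "(1 + z / 2)^2 \<le> (exp (z / 2))^2"
    by (intro power_mono exp_ge_add_one_self)
  also have "(exp (z / 2))^2 = exp z" by (simp add: exp_double[symmetric])
  finally have "z^2 / 4 \<le> exp z - 1 - z" by (simp add: power2_eq_square field_simps)
  then have "(z / 2)^2 \<le> d" using assms by (simp add: power_divide)
  then have "\<bar>z / 2\<bar> \<le> sqrt d" by (metis real_sqrt_abs real_sqrt_le_mono)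
  then show ?thesis by simp
qed

context regular_graph
begin

text \<open>
  The logarithm of the ratio between the transition weight \<open>exp (- h \<cdot> l f) \<cdot> u f / u e\<close> and the
  transition probability \<open>1 / k\<close> of the uniform walk without backtracking.
\<close>

definition log_ratio :: "real \<Rightarrow> ('b \<Rightarrow> real) \<Rightarrow> ('b \<Rightarrow> real) \<Rightarrow> 'b \<Rightarrow> 'b \<Rightarrow> real" where
  "log_ratio h l u e f = ln (real k) - h * l f + ln (u f) - ln (u e)"

text \<open>
  At a positive eigenvector for the eigenvalue 1 the inequality is an equality, and then \<open>h\<close>
  is the entropy. The inequality is what convergent sums over walks provide for
  every larger \<open>h\<close>.
\<close>

definition subinvariant :: "real \<Rightarrow> ('b \<Rightarrow> real) \<Rightarrow> ('b \<Rightarrow> real) \<Rightarrow> bool" where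
  "subinvariant h l u \<longleftrightarrow>
     (\<forall>e\<in>arcs G. 0 < u e \<and> (\<Sum>f\<in>continuations e. exp (- h * l f) * u f) \<le> u e)"

text \<open>
  Subinvariance bounds the sum of \<open>exp\<close> of the log ratios at every arc by \<open>k\<close>, while the
  sum of the log ratios themselves does not depend on \<open>u\<close>, by stationarity (\<open>sum_continuations\<close>). The defect
  compares both sides of \<open>1 + z \<le> exp z\<close>.
\<close>

lemma sum_exp_defect_le:
  assumes fin: "finite (arcs G)" and sub: "subinvariant h l u"
  shows "(\<Sum>e\<in>arcs G. \<Sum>f\<in>continuations e.
            exp (log_ratio h l u e f) - 1 - log_ratio h l u e f)
         \<le> real k * (h * (\<Sum>e\<in>arcs G. l e) - real (card (arcs G)) * ln (real k))"
proof -
  let ?z = "log_ratio h l u"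
  have k: "real k > 0" using k_gt_1 by simp
  have pos: "0 < u e" if "e \<in> arcs G" for e using sub that by (simp add: subinvariant_def)
  have le_k: "(\<Sum>f\<in>continuations e. exp (?z e f)) \<le> real k" if e: "e \<in> arcs G" for e
  proof -
    have "exp (?z e f) = real k / u e * (exp (- h * l f) * u f)" if "f \<in> continuations e" for f
      using k pos[OF e] pos[of f] that
      by (simp add: log_ratio_def exp_add exp_diff exp_minus continuations_iff field_simps)
    then have "(\<Sum>f\<in>continuations e. exp (?z e f)) =
        real k / u e * (\<Sum>f\<in>continuations e. exp (- h * l f) * u f)"
      by (simp add: sum_distrib_left)
    also have "\<dots> \<le> real k / u e * u e"
      using sub e k pos[OF e] by (intro mult_left_mono) (auto simp: subinvariant_def)
    finally show ?thesis using pos[OF e] by simp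
  qed
  have "(\<Sum>e\<in>arcs G. \<Sum>f\<in>continuations e. exp (?z e f) - 1 - ?z e f) \<le>
      (\<Sum>e\<in>arcs G. - (\<Sum>f\<in>continuations e. ?z e f))"
    using le_k by (intro sum_mono) (simp add: sum_subtractf card_continuations)
  also have "\<dots> = - (\<Sum>e\<in>arcs G. (\<Sum>f\<in>continuations e. ln (real k) - h * l f + ln (u f)) - real k * ln (u e))"
    by (simp add: log_ratio_def sum_subtractf sum_negf card_continuations)
  also have "\<dots> = real k * (h * (\<Sum>e\<in>arcs G. l e) - real (card (arcs G)) * ln (real k))"
    using fin unfolding sum_subtractf sum_continuations[OF fin] sum.distrib
    by (simp add: sum_distrib_left[symmetric] algebra_simps)
  finally show ?thesis .
qed

lemma exp_defect_le:
  assumes fin: "finite (arcs G)" and sub: "subinvariant h l u"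
    and e: "e \<in> arcs G" and f: "f \<in> continuations e"
  shows "exp (log_ratio h l u e f) - 1 - log_ratio h l u e f
         \<le> real k * (h * (\<Sum>e\<in>arcs G. l e) - real (card (arcs G)) * ln (real k))"
proof -
  let ?d = "\<lambda>e f. exp (log_ratio h l u e f) - 1 - log_ratio h l u e f"
  have nonneg: "?d e f \<ge> 0" for e f using exp_ge_add_one_self[of "log_ratio h l u e f"] by linarith
  have "?d e f \<le> (\<Sum>f\<in>continuations e. ?d e f)"
    using f nonneg finite_continuations[OF e] by (intro member_le_sum) auto
  also have "\<dots> \<le> (\<Sum>e\<in>arcs G. \<Sum>f\<in>continuations e. ?d e f)"
    using e nonneg fin
    by (intro member_le_sum[where f = "\<lambda>e. \<Sum>f\<in>continuations e. ?d e f"] sum_nonneg) auto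
  finally show ?thesis using sum_exp_defect_le[OF fin sub] by linarith
qed

text \<open>
  Up to errors of size \<open>2 d\<close> the quantity \<open>q\<close> of the proof takes opposite values at any two
  arcs with the same tail. Since every vertex has three arcs, \<open>q\<close> must be almost 0. In the sum of
  \<open>q\<close> over an arc and its reverse the weights cancel, and the two equal lengths remain.
\<close>

lemma scaled_length_near_log_k:
  assumes sym: "l (arev a) = l a" and a: "a \<in> arcs G"
    and z: "\<And>e f. e \<in> arcs G \<Longrightarrow> f \<in> continuations e \<Longrightarrow> \<bar>log_ratio h l u e f\<bar> \<le> d"
  shows "\<bar>h * l a - ln (real k)\<bar> \<le> 3 * d"
proof -
  define q where "q a = ln (u a) - ln (u (arev a)) - (h * l a - ln (real k))" for a
  have pair: "\<bar>q a + q b\<bar> \<le> 2 * d"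
    if "a \<in> arcs G" "b \<in> arcs G" "tail G a = tail G b" "a \<noteq> b" for a b
  proof -
    have "q a + q b = log_ratio h l u (arev b) a + log_ratio h l u (arev a) b"
      by (simp add: q_def log_ratio_def)
    moreover have "a \<in> continuations (arev b)" "b \<in> continuations (arev a)"
      using that by (auto simp: continuations_iff)
    ultimately show ?thesis using z[of "arev b" a] z[of "arev a" b] that by simp
  qed
  have q_small: "\<bar>q a\<bar> \<le> 3 * d" if a: "a \<in> arcs G" for a
  proof -
    have "2 \<le> card (continuations (arev a))" using card_continuations[of "arev a"] a k_gt_1 by simp
    then obtain b c where "b \<in> continuations (arev a)" "c \<in> continuations (arev a)" "b \<noteq> c"
      by (auto simp: card_le_Suc_iff numeral_2_eq_2)
    then have "\<bar>q a + q b\<bar> \<le> 2 * d" "\<bar>q a + q c\<bar> \<le> 2 * d" "\<bar>q b + q c\<bar> \<le> 2 * d"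
      using a by (auto simp: continuations_iff intro!: pair)
    then show ?thesis by linarith
  qed
  have "q a + q (arev a) = - 2 * (h * l a - ln (real k))"
    using sym by (simp add: q_def)
  then show ?thesis using q_small[OF a] q_small[of "arev a"] a by simp
qed

lemma entropy_lower_bound:
  assumes "finite (arcs G)" "subinvariant h l u" "(\<Sum>e\<in>arcs G. l e) = 2"
  shows "real (card (arcs G)) / 2 * ln (real k) \<le> h"
proof -
  have "0 \<le> (\<Sum>e\<in>arcs G. \<Sum>f\<in>continuations e.
            exp (log_ratio h l u e f) - 1 - log_ratio h l u e f)"
  proof (intro sum_nonneg)
    fix e f show "0 \<le> exp (log_ratio h l u e f) - 1 - log_ratio h l u e f"
      using exp_ge_add_one_self[of "log_ratio h l u e f"] by linarith
  qed
  also note sum_exp_defect_le[OF assms(1,2)]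
  finally show ?thesis using k_gt_1 assms(3) by (simp add: zero_le_mult_iff)
qed

text \<open>
  With \<open>h = h0 + d / (2 * k)\<close> the total defect is at most \<open>d\<close>, and \<open>d\<close> tends to 0.
\<close>

lemma lengths_determined_at_minimum:
  assumes fin: "finite (arcs G)" and sum2: "(\<Sum>e\<in>arcs G. l e) = 2"
    and sym: "\<And>e. e \<in> arcs G \<Longrightarrow> l (arev e) = l e"
    and sub: "\<And>h. real (card (arcs G)) / 2 * ln (real k) < h \<Longrightarrow> \<exists>u. subinvariant h l u"
    and a: "a \<in> arcs G"
  shows "l a = 2 / real (card (arcs G))"
proof -
  define h0 where "h0 = real (card (arcs G)) / 2 * ln (real k)"
  have k: "real k > 0" using k_gt_1 by simp
  have bound: "\<bar>(h0 + d / (2 * real k)) * l a - ln (real k)\<bar> \<le> 6 * sqrt d"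
    if d: "0 < d" "d \<le> 1" for d
  proof -
    define h where "h = h0 + d / (2 * real k)"
    have "h > h0" using d k by (simp add: h_def)
    then obtain u where u: "subinvariant h l u" using sub unfolding h0_def by auto
    have eq: "real k * (h * (\<Sum>e\<in>arcs G. l e) - real (card (arcs G)) * ln (real k)) = d"
      using k by (simp add: h_def h0_def sum2 field_simps)
    have "\<bar>log_ratio h l u e f\<bar> \<le> 2 * sqrt d" if "e \<in> arcs G" "f \<in> continuations e" for e f
      using abs_le_of_exp_defect exp_defect_le[OF fin u that] d eq by simp
    from scaled_length_near_log_k[OF sym[OF a] a this] show ?thesis by (simp add: h_def)
  qed
  let ?d = "\<lambda>n. inverse (real (Suc n))"
  have "(\<lambda>n. \<bar>(h0 + ?d n / (2 * real k)) * l a - ln (real k)\<bar>)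
      \<longlonglongrightarrow> \<bar>(h0 + 0 / (2 * real k)) * l a - ln (real k)\<bar>"
    by (intro tendsto_intros LIMSEQ_inverse_real_of_nat) (use k in auto)
  moreover have "(\<lambda>n. 6 * sqrt (?d n)) \<longlonglongrightarrow> 6 * sqrt 0"
    by (intro tendsto_intros LIMSEQ_inverse_real_of_nat)
  moreover have "\<bar>(h0 + ?d n / (2 * real k)) * l a - ln (real k)\<bar> \<le> 6 * sqrt (?d n)" for n
    by (rule bound) (auto simp: field_simps)
  ultimately have "\<bar>(h0 + 0 / (2 * real k)) * l a - ln (real k)\<bar> \<le> 6 * sqrt 0"
    by (meson LIMSEQ_le)
  then have "ln (real k) * (real (card (arcs G)) / 2 * l a) = ln (real k) * 1"
    by (simp add: h0_def mult_ac)
  moreover have "ln (real k) > 0" using k_gt_1 by simp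
  ultimately have "real (card (arcs G)) / 2 * l a = 1" by simp
  moreover have "card (arcs G) > 0" using a fin card_gt_0_iff by blast
  ultimately show ?thesis by (simp add: field_simps)
qed

end

section \<open>Reduced walks\<close>

context bidirected_digraph
begin

lemma reduced_append:
  "reduced (p @ q) \<longleftrightarrow>
     reduced p \<and> reduced q \<and> (p \<noteq> [] \<longrightarrow> q \<noteq> [] \<longrightarrow> hd q \<noteq> arev (last p))"
proof (induction p rule: reduced.induct)
  case (2 e) then show ?case by (cases q) auto
qed auto

lemma reduced_rev_map_arev: "reduced (rev (map arev p)) \<longleftrightarrow> reduced p"
proof (induction p rule: reduced.induct)
  case (3 e f p)
  then show ?case by (auto simp: reduced_append arev_eq_iff)
qed auto

lemma awalk_rev_map_arev: "awalk u p v \<Longrightarrow> awalk v (rev (map arev p)) u"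
proof (induction p arbitrary: u)
  case (Cons e p)
  then have "awalk v (rev (map arev p)) (head G e)" "e \<in> arcs G" "u = tail G e"
    by (auto simp: awalk_Cons_iff)
  then show ?case by (auto simp: awalk_snoc simp del: awalk_append_iff)
qed (auto simp: awalk_Nil_iff)

lemma path_verts_awalk: "p \<in> path_verts v \<Longrightarrow> awalk v p (path_end v p)"
  and path_verts_reduced: "p \<in> path_verts v \<Longrightarrow> reduced p"
  by (simp_all add: path_verts_def)

lemma path_end_snoc: "path_end v (p @ [a]) = head G a"
  by (simp add: path_end_def)

lemma path_end_in_verts: "p \<in> path_verts v \<Longrightarrow> path_end v p \<in> verts G"
  using path_verts_awalk by blast

lemma path_verts_arcs: "p \<in> path_verts v \<Longrightarrow> set p \<subseteq> arcs G"
  using path_verts_awalk by blast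

lemma Nil_in_path_verts: "v \<in> verts G \<Longrightarrow> [] \<in> path_verts v"
  by (simp add: path_verts_def path_end_def awalk_Nil_iff)

lemma path_verts_snoc_continuation:
  "p @ [a] \<in> path_verts v \<Longrightarrow> b \<in> continuations a \<Longrightarrow> p @ [a, b] \<in> path_verts v"
  using path_verts_snoc[of "p @ [a]" b v] by (auto simp: continuations_iff path_end_snoc)

text \<open>
  Appending an arc to a reduced walk either keeps it reduced or cancels its last arc.
\<close>

lemma shorten_to_reduced_walk:
  assumes "awalk v p w"
  shows "\<exists>q\<in>path_verts v. path_end v q = w \<and> length q \<le> length p"
  using assms
proof (induction p arbitrary: w rule: rev_induct)
  case Nil
  then show ?case using Nil_in_path_verts by (auto simp: awalk_Nil_iff path_end_def)
next
  case (snoc a p)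
  then have a: "awalk v p (tail G a)" "a \<in> arcs G" "w = head G a"
    by (simp_all add: awalk_snoc del: awalk_append_iff)
  from snoc.IH[OF a(1)] obtain q where
    q: "q \<in> path_verts v" "path_end v q = tail G a" "length q \<le> length p" by auto
  then have "(q, a) \<in> path_arcs v" using a by (simp add: path_arcs_def)
  moreover have "length (path_head (q, a)) \<le> Suc (length q)"
    by (simp add: path_head_def le_SucI)
  ultimately show ?case
    using path_head_in path_end_head q a by fastforce
qed

text \<open>
  A shortest counterexample visits no vertex twice, since otherwise the closed part between the two
  visits would be a shorter one. It is therefore a cycle, but the only cycles are the round
  trips along an edge, which backtrack.
\<close>

lemma reduced_closed_walk_Nil:
  assumes acyclic: "\<And>p. cycle p \<Longrightarrow> \<exists>e. p = [e, arev e]"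
    and "awalk u p u" "reduced p"
  shows "p = []"
  using assms(2,3)
proof (induction "length p" arbitrary: u p rule: less_induct)
  case less
  show ?case
  proof (cases p)
    case p: (Cons e es)
    then have es: "awalk (head G e) es u" using less.prems by (simp only: awalk_Cons_iff) blast
    show ?thesis
    proof (cases "distinct (awalk_verts (head G e) es)")
      case True
      then have "cycle p" unfolding cycle_def
        using less.prems(1) p by (intro exI[of _ u]) simp
      then show ?thesis using acyclic less.prems by fastforce
    next
      case False
      then obtain q r s v where "es = q @ r @ s" "awalk v r v" "0 < length r"
        using awalk_not_distinct_decomp[OF es] by blast
      moreover from this have "reduced r"
        using less.prems p reduced_append[of "e # q" "r @ s"] reduced_append[of r s] by simp
      ultimately show ?thesis using less.hyps[of r v] p by simp
    qed
  qed simp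
qed

text \<open>
  After common final arcs are removed, one walk followed by the reverse of the other is a
  reduced closed walk.
\<close>

lemma reduced_walk_unique:
  assumes acyclic: "\<And>p. cycle p \<Longrightarrow> \<exists>e. p = [e, arev e]"
    and "p \<in> path_verts v" "q \<in> path_verts v" "path_end v p = path_end v q"
  shows "p = q"
  using assms(2-)
proof (induction p arbitrary: q rule: rev_induct)
  case Nil
  then have "awalk v q v" "reduced q" by (auto simp: path_verts_def path_end_def)
  then show ?case using reduced_closed_walk_Nil[OF acyclic] by blast
next
  case (snoc a p)
  show ?case
  proof (cases q rule: rev_cases)
    case Nil
    then have "awalk v (p @ [a]) v" "reduced (p @ [a])"
      using snoc.prems(1,3) by (simp_all add: path_verts_def path_end_def del: awalk_append_iff)
    then show ?thesis using reduced_closed_walk_Nil[OF acyclic] by blast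
  next
    case q: (snoc q' b)
    show ?thesis
    proof (cases "a = b")
      case True
      have "p \<in> path_verts v" "q' \<in> path_verts v" "path_end v p = path_end v q'"
        using snoc.prems(1,2) q True by (auto simp: path_verts_snoc)
      then have "p = q'" by (rule snoc.IH)
      then show ?thesis using True q by simp
    next
      case False
      let ?r = "(p @ [a]) @ rev (map arev q)"
      have "awalk v (p @ [a]) (path_end v q)" "awalk (path_end v q) (rev (map arev q)) v"
        using path_verts_awalk[OF snoc.prems(1)] snoc.prems(3)
          awalk_rev_map_arev[OF path_verts_awalk[OF snoc.prems(2)]]
        by (simp_all del: awalk_append_iff)
      then have "awalk v ?r v" by (rule awalk_appendI)
      moreover have "reduced ?r"
        using path_verts_reduced[OF snoc.prems(1)] path_verts_reduced[OF snoc.prems(2)] False q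
        unfolding reduced_append[of "p @ [a]" "rev (map arev q)"] reduced_rev_map_arev
        by (simp add: arev_eq_iff)
      ultimately show ?thesis using reduced_closed_walk_Nil[OF acyclic] by blast
    qed
  qed
qed

text \<open>
  This turns sums over reduced walks into sums over arcs of the tree.
\<close>

lemma inj_on_last_path_verts:
  assumes "\<And>p. cycle p \<Longrightarrow> \<exists>e. p = [e, arev e]"
  shows "inj_on last (path_verts v - {[]})"
proof (rule inj_onI)
  fix p q assume "p \<in> path_verts v - {[]}" "q \<in> path_verts v - {[]}" "last p = last q"
  then show "p = q" using reduced_walk_unique[OF assms, of p v q] by (auto simp: path_end_def)
qed

end

section \<open>The volume of balls\<close>

context regular_graph
begin

text \<open>
  The first arc has \<open>k + 1\<close> choices and every later arc has \<open>k\<close>. The bound is generous by a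
  factor \<open>k\<close> so that it covers the empty walk as well.
\<close>

lemma reduced_walks_of_length:
  "finite {p \<in> path_verts v. length p = n} \<and>
   card {p \<in> path_verts v. length p = n} \<le> (k + 1) * k ^ n"
proof (induction n)
  case 0
  have "{p \<in> path_verts v. length p = 0} = (if [] \<in> path_verts v then {[]} else {})" by auto
  then show ?case by simp
next
  case (Suc n)
  let ?W = "\<lambda>n. {p \<in> path_verts v. length p = n}"
  let ?E = "\<lambda>p. {a. p @ [a] \<in> path_verts v}"
  have sub: "?E p \<subseteq> (if p = [] then out_arcs G (path_end v p) else continuations (last p))" for p
    by (auto simp: path_verts_snoc continuations_iff path_end_def)
  have E: "finite (?E p) \<and> card (?E p) \<le> (if p = [] then k + 1 else k)" if p: "p \<in> path_verts v" for p
  proof (cases "p = []")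
    case True
    then have "?E p \<subseteq> out_arcs G (path_end v p)" using sub[of p] by simp
    with path_end_in_verts[OF p] True show ?thesis
      using card_mono[OF finite_out_arcs_regular] finite_subset[OF _ finite_out_arcs_regular]
      by (simp add: card_out_arcs del: in_out_arcs_conv)
  next
    case False
    then have "last p \<in> arcs G" using path_verts_arcs[OF p] by auto
    moreover have "?E p \<subseteq> continuations (last p)" using sub[of p] False by simp
    ultimately show ?thesis
      using card_mono[OF finite_continuations] finite_subset[OF _ finite_continuations] False
      by (simp add: card_continuations)
  qed
  have eq: "?W (Suc n) = (\<Union>p\<in>?W n. (\<lambda>a. p @ [a]) ` ?E p)"
  proof (intro equalityI subsetI)
    fix p assume p: "p \<in> ?W (Suc n)"
    then obtain q a where "p = q @ [a]" by (cases p rule: rev_cases) auto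
    with p show "p \<in> (\<Union>p\<in>?W n. (\<lambda>a. p @ [a]) ` ?E p)" by (auto simp: path_verts_snoc)
  qed auto
  have fin: "finite (?W (Suc n))" unfolding eq using Suc E by auto
  have "card (?W (Suc n)) \<le> (\<Sum>p\<in>?W n. card ((\<lambda>a. p @ [a]) ` ?E p))"
    unfolding eq using Suc by (intro card_UN_le) auto
  also have "\<dots> \<le> (\<Sum>p\<in>?W n. if n = 0 then k + 1 else k)"
  proof (rule sum_mono)
    fix p assume p: "p \<in> ?W n"
    have "card ((\<lambda>a. p @ [a]) ` ?E p) \<le> card (?E p)" using E p by (intro card_image_le) auto
    also have "\<dots> \<le> (if n = 0 then k + 1 else k)" using E[of p] p by auto
    finally show "card ((\<lambda>a. p @ [a]) ` ?E p) \<le> (if n = 0 then k + 1 else k)" .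
  qed
  also have "\<dots> \<le> (k + 1) * k ^ Suc n"
  proof (cases "n = 0")
    case True
    have "?W 0 = (if [] \<in> path_verts v then {[]} else {})" by auto
    then have "card (?W 0) \<le> 1" by simp
    then have "card (?W 0) * (k + 1) \<le> 1 * (k + 1)" by (rule mult_le_mono1)
    also have "\<dots> \<le> k * (k + 1)" using k_gt_1 by (intro mult_le_mono1) simp
    finally show ?thesis using True by (simp add: mult.commute)
  next
    case False
    then show ?thesis using Suc mult_le_mono1[of "card (?W n)" _ k] by (simp add: mult_ac)
  qed
  finally show ?case using fin by blast
qed

lemma sum_powers_le: "(\<Sum>n\<le>N. k ^ n) \<le> 2 * k ^ N"
proof (induction N)
  case (Suc N)
  have "2 * k ^ N \<le> k ^ Suc N" unfolding power_Suc using k_gt_1 by (intro mult_le_mono1) simp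
  then have "(\<Sum>n\<le>N. k ^ n) \<le> k ^ Suc N" using Suc by linarith
  then show ?case by simp
qed simp

lemma reduced_walks_up_to_length:
  "finite {p \<in> path_verts v. length p \<le> N} \<and>
   card {p \<in> path_verts v. length p \<le> N} \<le> 2 * (k + 1) * k ^ N"
proof -
  have eq: "{p \<in> path_verts v. length p \<le> N} = (\<Union>n\<in>{..N}. {p \<in> path_verts v. length p = n})"
    by auto
  have "card {p \<in> path_verts v. length p \<le> N} \<le> (\<Sum>n\<le>N. card {p \<in> path_verts v. length p = n})"
    unfolding eq by (intro card_UN_le) auto
  also have "\<dots> \<le> (\<Sum>n\<le>N. (k + 1) * k ^ n)"
    using reduced_walks_of_length by (intro sum_mono) blast
  also have "\<dots> = (k + 1) * (\<Sum>n\<le>N. k ^ n)" by (simp add: sum_distrib_left)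
  also have "\<dots> \<le> (k + 1) * (2 * k ^ N)" using sum_powers_le by (intro mult_le_mono) auto
  finally show ?thesis using reduced_walks_of_length unfolding eq by (auto simp: mult_ac)
qed

end

context regular_graph
begin

definition arcs_meeting_ball :: "('b \<Rightarrow> real) \<Rightarrow> 'a \<Rightarrow> real \<Rightarrow> 'b set" where
  "arcs_meeting_ball l v r = {e \<in> arcs G. \<exists>s\<in>{0..l e}. point_dist G l v e s < ereal r}"

lemma length_le_awalk_cost:
  assumes "\<And>e. e \<in> arcs G \<Longrightarrow> m \<le> l e" "set p \<subseteq> arcs G"
  shows "m * real (length p) \<le> awalk_cost l p"
  using assms(2)
proof (induction p)
  case (Cons e p)
  then have "m * real (length p) \<le> awalk_cost l p" "m \<le> l e" using assms(1) by auto
  then show ?case by (simp add: algebra_simps)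
qed simp

lemma short_reduced_walk_of_dist_less:
  assumes l: "\<And>e. e \<in> arcs G \<Longrightarrow> m \<le> l e" and m: "m > 0"
    and less: "\<mu> l v w + ereal t < ereal r" and t: "t \<ge> 0"
  shows "\<exists>p\<in>path_verts v. path_end v p = w \<and> real (length p) \<le> r / m"
proof -
  have "\<mu> l v w \<le> \<mu> l v w + ereal t" using t by (simp add: ereal_le_add_self)
  then have "\<mu> l v w < ereal r" using less by (rule le_less_trans)
  then obtain p where p: "awalk v p w" "awalk_cost l p < r"
    by (auto simp: \<mu>_def INF_less_iff)
  have "set p \<subseteq> arcs G" using p(1) by blast
  with l have "m * real (length p) \<le> awalk_cost l p" by (rule length_le_awalk_cost)
  then have "real (length p) \<le> r / m" using p(2) m by (simp add: field_simps)
  then show ?thesis using shorten_to_reduced_walk[OF p(1)] by fastforce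
qed

text \<open>
  A point at distance less than \<open>r\<close> is reached through an end of its arc, and this end is the end
  of a reduced walk with at most \<open>r / m\<close> arcs. At each such end there are \<open>k + 1\<close> outgoing and
  \<open>k + 1\<close> incoming arcs. Finiteness is as important as the bound: an infinite sum
  that does not converge would have the value 0.
\<close>

lemma arcs_meeting_ball_bound:
  assumes l: "\<And>e. e \<in> arcs G \<Longrightarrow> m \<le> l e" and m: "m > 0" and r: "r \<ge> 0"
  shows "finite (arcs_meeting_ball l v r)"
    and "real (card (arcs_meeting_ball l v r)) \<le> 4 * (real k + 1)^2 * exp (ln (real k) / m * r)"
proof -
  define N where "N = nat \<lfloor>r / m\<rfloor>"
  define W where "W = {p \<in> path_verts v. length p \<le> N}"
  define S where "S p = out_arcs G (path_end v p) \<union> arev ` out_arcs G (path_end v p)" for p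
  have W: "finite W" "card W \<le> 2 * (k + 1) * k ^ N"
    using reduced_walks_up_to_length unfolding W_def by auto
  have S: "finite (S p) \<and> card (S p) \<le> 2 * (k + 1)" if "p \<in> W" for p
  proof -
    have v: "path_end v p \<in> verts G" using that path_end_in_verts by (simp add: W_def)
    have "card (S p) \<le> card (out_arcs G (path_end v p)) + card (arev ` out_arcs G (path_end v p))"
      unfolding S_def by (rule card_Un_le)
    then show ?thesis
      using finite_out_arcs_regular[OF v] card_out_arcs[OF v]
      by (simp add: S_def card_image inj_on_arev)
  qed
  have sub: "arcs_meeting_ball l v r \<subseteq> (\<Union>p\<in>W. S p)"
  proof
    fix e assume "e \<in> arcs_meeting_ball l v r"
    then obtain s where e: "e \<in> arcs G" "0 \<le> s" "s \<le> l e"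
      and "min (\<mu> l v (tail G e) + ereal s) (\<mu> l v (head G e) + ereal (l e - s)) < ereal r"
      by (auto simp: arcs_meeting_ball_def point_dist_def)
    then consider "\<mu> l v (tail G e) + ereal s < ereal r" | "\<mu> l v (head G e) + ereal (l e - s) < ereal r"
      by (auto simp: min_less_iff_disj)
    then have "\<exists>p\<in>path_verts v. (path_end v p = tail G e \<or> path_end v p = head G e)
        \<and> real (length p) \<le> r / m"
    proof cases
      case 1
      from short_reduced_walk_of_dist_less[OF l m this e(2)] show ?thesis by blast
    next
      case 2
      have "0 \<le> l e - s" using e(3) by simp
      from short_reduced_walk_of_dist_less[OF l m 2 this] show ?thesis by blast
    qed
    then obtain p where p: "p \<in> path_verts v" "real (length p) \<le> r / m"
      and "path_end v p = tail G e \<or> path_end v p = head G e" by blast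
    then have "e \<in> S p" "p \<in> W"
      using e le_nat_floor[of "length p" "r / m"]
      by (auto simp: S_def W_def N_def intro!: image_eqI[of e arev "arev e"])
    then show "e \<in> (\<Union>p\<in>W. S p)" by blast
  qed
  show fin: "finite (arcs_meeting_ball l v r)"
    using sub W S by (meson finite_UN_I finite_subset)
  have "card (arcs_meeting_ball l v r) \<le> card (\<Union>p\<in>W. S p)"
    using sub W S by (intro card_mono) auto
  also have "\<dots> \<le> (\<Sum>p\<in>W. card (S p))" using W by (intro card_UN_le) auto
  also have "\<dots> \<le> (\<Sum>p\<in>W. 2 * (k + 1))" using S by (intro sum_mono) auto
  also have "\<dots> = card W * (2 * (k + 1))" by simp
  also have "\<dots> \<le> (2 * (k + 1) * k ^ N) * (2 * (k + 1))" using W(2) by (rule mult_le_mono1)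
  finally have "real (card (arcs_meeting_ball l v r)) \<le> real ((2 * (k + 1) * k ^ N) * (2 * (k + 1)))"
    by (rule of_nat_mono)
  also have "\<dots> = 4 * (real k + 1)^2 * real k ^ N" by (simp add: power2_eq_square algebra_simps)
  also have "real k ^ N = exp (ln (real k) * real N)"
    using k_gt_1 by (simp add: exp_of_nat2_mult)
  also have "ln (real k) * real N \<le> ln (real k) * (r / m)"
    using k_gt_1 r m by (intro mult_left_mono) (auto simp: N_def)
  finally show "real (card (arcs_meeting_ball l v r)) \<le> 4 * (real k + 1)^2 * exp (ln (real k) / m * r)"
    by (simp add: mult_left_mono)
qed

lemma ball_length_eq_sum:
  assumes "finite (arcs_meeting_ball l v r)"
  shows "ball_length G l v r =
    (\<Sum>e\<in>arcs_meeting_ball l v r. measure lborel {s \<in> {0..l e}. point_dist G l v e s < ereal r}) / 2"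
proof -
  have "(\<Sum>\<^sub>\<infinity>e\<in>arcs G. measure lborel {s \<in> {0..l e}. point_dist G l v e s < ereal r}) =
    (\<Sum>\<^sub>\<infinity>e\<in>arcs_meeting_ball l v r. measure lborel {s \<in> {0..l e}. point_dist G l v e s < ereal r})"
  proof (rule infsum_cong_neutral)
    fix e assume "e \<in> arcs G - arcs_meeting_ball l v r"
    then have "{s \<in> {0..l e}. point_dist G l v e s < ereal r} = {}"
      by (auto simp: arcs_meeting_ball_def)
    then show "measure lborel {s \<in> {0..l e}. point_dist G l v e s < ereal r} = 0"
      by (simp only: measure_empty)
  qed (auto simp: arcs_meeting_ball_def)
  then show ?thesis using assms by (simp add: ball_length_def)
qed

lemma ball_length_upper:
  assumes l: "\<And>e. e \<in> arcs G \<Longrightarrow> m \<le> l e" "\<And>e. e \<in> arcs G \<Longrightarrow> l e \<le> M"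
    and m: "m > 0" and r: "r \<ge> 0" and M: "M \<ge> 0"
  shows "ball_length G l v r \<le> 2 * (real k + 1)^2 * M * exp (ln (real k) / m * r)"
proof -
  let ?A = "\<lambda>e. {s \<in> {0..l e}. point_dist G l v e s < ereal r}"
  have "measure lborel (?A e) \<le> M" if e: "e \<in> arcs G" for e
  \<comment> \<open>Measurability need not be established: outside the Borel sets the measure is 0 by convention.\<close>
  proof (cases "?A e \<in> sets lborel")
    case True
    then have "measure lborel (?A e) \<le> measure lborel {0..l e}"
      by (intro measure_mono_fmeasurable) (auto simp: fmeasurable_def emeasure_lborel_Icc_eq)
    also have "\<dots> \<le> M" using l(1,2)[OF e] m by simp
    finally show ?thesis .
  next
    case False
    then show ?thesis using M measure_notin_sets by fastforce
  qed
  then have "(\<Sum>e\<in>arcs_meeting_ball l v r. measure lborel (?A e)) \<le> (\<Sum>e\<in>arcs_meeting_ball l v r. M)"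
    by (intro sum_mono) (auto simp: arcs_meeting_ball_def)
  also have "\<dots> = real (card (arcs_meeting_ball l v r)) * M" by simp
  also have "\<dots> \<le> (4 * (real k + 1)^2 * exp (ln (real k) / m * r)) * M"
    using arcs_meeting_ball_bound(2)[OF l(1) m r] M by (rule mult_right_mono)
  finally have "(\<Sum>e\<in>arcs_meeting_ball l v r. measure lborel (?A e)) / 2
      \<le> 2 * (real k + 1)^2 * M * exp (ln (real k) / m * r)"
    by (simp add: mult_ac)
  moreover have "finite (arcs_meeting_ball l v r)" by (rule arcs_meeting_ball_bound(1)[OF l(1) m r])
  ultimately show ?thesis by (simp only: ball_length_eq_sum)
qed

text \<open>
  A reduced walk of length less than \<open>r\<close> ends with an arc that lies entirely in the ball, and
  different walks have different last arcs.
\<close>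

lemma ball_length_lower:
  assumes acyclic: "\<And>p. cycle p \<Longrightarrow> \<exists>e. p = [e, arev e]"
    and l: "\<And>e. e \<in> arcs G \<Longrightarrow> m \<le> l e" and m: "m > 0" and r: "r \<ge> 0"
    and F: "F \<subseteq> path_verts v - {[]}" "\<And>p. p \<in> F \<Longrightarrow> awalk_cost l p < r"
  shows "real (card F) * m / 2 \<le> ball_length G l v r"
proof -
  let ?A = "\<lambda>e. {s \<in> {0..l e}. point_dist G l v e s < ereal r}"
  have full: "last p \<in> arcs_meeting_ball l v r \<and> ?A (last p) = {0..l (last p)}"
    if p: "p \<in> F" for p
  proof -
    obtain q a where q: "p = q @ [a]" using F(1) p by (cases p rule: rev_cases) auto
    have a: "a \<in> arcs G" "awalk v q (tail G a)"
      using p F(1) path_verts_awalk[of p v] unfolding q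
      by (auto simp: awalk_snoc simp del: awalk_append_iff)
    have "point_dist G l v a s < ereal r" if "s \<in> {0..l a}" for s
    proof -
      have "point_dist G l v a s \<le> \<mu> l v (tail G a) + ereal s" by (simp add: point_dist_def)
      also have "\<dots> \<le> ereal (awalk_cost l q) + ereal s"
        using min_cost_le_walk_cost[OF a(2)] by (intro add_right_mono)
      also have "\<dots> \<le> ereal (awalk_cost l p)" using that by (simp add: q)
      also have "\<dots> < ereal r" using F(2)[OF p] by simp
      finally show ?thesis .
    qed
    moreover have "0 \<le> l a" using l[OF a(1)] m by simp
    ultimately show ?thesis using a(1) by (auto simp: q arcs_meeting_ball_def)
  qed
  have fin: "finite (arcs_meeting_ball l v r)" by (rule arcs_meeting_ball_bound(1)[OF l m r])
  have inj: "inj_on last F" using inj_on_last_path_verts[OF acyclic] F(1) by (rule inj_on_subset)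
  have "real (card F) * m = (\<Sum>e\<in>last ` F. m)" using inj by (simp add: card_image)
  also have "\<dots> \<le> (\<Sum>e\<in>last ` F. measure lborel (?A e))"
  proof (rule sum_mono)
    fix e assume "e \<in> last ` F"
    with full have "e \<in> arcs G" "?A e = {0..l e}" by (auto simp: arcs_meeting_ball_def)
    then show "m \<le> measure lborel (?A e)" using l[of e] m by simp
  qed
  also have "\<dots> \<le> (\<Sum>e\<in>arcs_meeting_ball l v r. measure lborel (?A e))"
    using full fin by (intro sum_mono2) auto
  finally show ?thesis using ball_length_eq_sum[OF fin] by simp
qed

end

section \<open>Exponential sums over continuations\<close>

text \<open>
  The elements with \<open>n \<le> c q < n + 1\<close> contribute at most a constant times \<open>exp (h' - h) ^ n\<close>,
  and these bounds form a convergent geometric series.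
\<close>

lemma sum_exp_bounded_of_growth:
  fixes c :: "'x \<Rightarrow> real"
  assumes growth: "\<And>F r. \<lbrakk>finite F; F \<subseteq> Q; \<And>q. q \<in> F \<Longrightarrow> c q < r; r \<ge> 0\<rbrakk>
      \<Longrightarrow> real (card F) \<le> C * exp (h' * r)"
    and nonneg: "\<And>q. q \<in> Q \<Longrightarrow> 0 \<le> c q"
    and h: "0 \<le> h" "h' < h"
  shows "\<exists>B. \<forall>F. finite F \<longrightarrow> F \<subseteq> Q \<longrightarrow> (\<Sum>q\<in>F. exp (- h * c q)) \<le> B"
proof (intro exI allI impI)
  fix F assume F: "finite F" "F \<subseteq> Q"
  define x where "x = exp (- (h - h'))"
  have x: "0 < x" "x < 1" using h by (auto simp: x_def)
  have C: "0 \<le> C" using growth[of "{}" 0] by simp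
  let ?n = "\<lambda>q. nat \<lfloor>c q\<rfloor>"
  have block: "(\<Sum>q | q \<in> F \<and> ?n q = n. exp (- h * c q)) \<le> C * exp h' * x ^ n" for n
  proof -
    let ?F = "{q \<in> F. ?n q = n}"
    have n: "real n \<le> c q \<and> c q < real n + 1" if "q \<in> ?F" for q
      using that nonneg F(2) of_nat_nat[of "\<lfloor>c q\<rfloor>"] by auto
    have "(\<Sum>q\<in>?F. exp (- h * c q)) \<le> (\<Sum>q\<in>?F. exp (- h * real n))"
      using n h by (intro sum_mono) (auto intro: mult_left_mono)
    also have "\<dots> = real (card ?F) * exp (- h * real n)" by simp
    also have "\<dots> \<le> (C * exp (h' * (real n + 1))) * exp (- h * real n)"
      using F n by (intro mult_right_mono growth) auto
    also have "\<dots> = C * exp h' * x ^ n"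
      unfolding x_def exp_of_nat_mult[symmetric] by (simp add: exp_add[symmetric] algebra_simps)
    finally show ?thesis .
  qed
  have "(\<Sum>q\<in>F. exp (- h * c q)) = (\<Sum>n\<in>?n ` F. \<Sum>q | q \<in> F \<and> ?n q = n. exp (- h * c q))"
    using F(1) by (rule sum.image_gen)
  also have "\<dots> \<le> (\<Sum>n\<in>?n ` F. C * exp h' * x ^ n)" by (intro sum_mono block)
  also have "\<dots> \<le> (\<Sum>n. C * exp h' * x ^ n)"
    using F x C by (intro sum_le_suminf summable_mult summable_geometric) auto
  finally show "(\<Sum>q\<in>F. exp (- h * c q)) \<le> (\<Sum>n. C * exp h' * x ^ n)" .
qed

context bidirected_digraph
begin

text \<open>
  The \<open>j\<close>-th iterate, applied to the constant function 1, of the transfer operator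
  \<open>g \<mapsto> (\<lambda>e. \<Sum>f\<in>continuations e. c f * g f)\<close>. It refers only to the arc \<open>e\<close>
  and not to walks, so it can be compared in a graph and in its covering.
\<close>

primrec continuation_sum :: "('b \<Rightarrow> real) \<Rightarrow> nat \<Rightarrow> 'b \<Rightarrow> real" where
  "continuation_sum c 0 e = 1"
| "continuation_sum c (Suc j) e = (\<Sum>f\<in>continuations e. c f * continuation_sum c j f)"

primrec extensions :: "nat \<Rightarrow> 'b \<Rightarrow> 'b list set" where
  "extensions 0 e = {[]}"
| "extensions (Suc j) e = (\<Union>f\<in>continuations e. (#) f ` extensions j f)"

lemma extensions_path_verts:
  assumes "p @ [a] \<in> path_verts v" "q \<in> extensions j a"
  shows "p @ a # q \<in> path_verts v \<and> length q = j"
  using assms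
proof (induction j arbitrary: p a q)
  case (Suc j)
  then obtain f q' where f: "f \<in> continuations a" "q' \<in> extensions j f" "q = f # q'" by auto
  have "(p @ [a]) @ [f] \<in> path_verts v" using path_verts_snoc_continuation Suc.prems(1) f(1) by simp
  from Suc.IH[OF this f(2)] f(3) show ?case by simp
qed simp

lemma continuation_sum_nonneg:
  "(\<And>e. 0 \<le> c e) \<Longrightarrow> 0 \<le> continuation_sum c j e"
  by (induction j arbitrary: e) (auto intro!: sum_nonneg)

end

context regular_graph
begin

lemma finite_extensions: "a \<in> arcs G \<Longrightarrow> finite (extensions j a)"
  by (induction j arbitrary: a) (auto simp: finite_continuations continuations_iff)

lemma sum_extensions:
  "a \<in> arcs G \<Longrightarrow>
    (\<Sum>q\<in>extensions j a. exp (- h * awalk_cost l q)) = continuation_sum (\<lambda>f. exp (- h * l f)) j a"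
proof (induction j arbitrary: a)
  case (Suc j)
  have "(\<Sum>q\<in>extensions (Suc j) a. exp (- h * awalk_cost l q)) =
      (\<Sum>f\<in>continuations a. \<Sum>q\<in>(#) f ` extensions j f. exp (- h * awalk_cost l q))"
    unfolding extensions.simps
    by (intro sum.UNION_disjoint)
      (auto simp: finite_continuations Suc.prems finite_extensions continuations_iff)
  also have "\<dots> = (\<Sum>f\<in>continuations a. \<Sum>q\<in>extensions j f. exp (- h * l f) * exp (- h * awalk_cost l q))"
    by (simp add: sum.reindex exp_add[symmetric] algebra_simps)
  also have "\<dots> = (\<Sum>f\<in>continuations a. exp (- h * l f) * continuation_sum (\<lambda>f. exp (- h * l f)) j f)"
    by (intro sum.cong refl) (simp only: sum_distrib_left[symmetric] Suc.IH continuations_iff)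
  finally show ?case by simp
qed simp

text \<open>
  Extending one fixed walk \<open>p @ [a]\<close> in all possible ways gives distinct reduced walks, whose
  weights are the weight of \<open>p @ [a]\<close> times the weight of the extension.
\<close>

lemma sum_continuation_sum_bounded:
  assumes bound: "\<And>F. finite F \<Longrightarrow> F \<subseteq> path_verts v - {[]} \<Longrightarrow> (\<Sum>q\<in>F. exp (- h * awalk_cost l q)) \<le> B"
    and pa: "p @ [a] \<in> path_verts v"
  shows "(\<Sum>j<J. continuation_sum (\<lambda>f. exp (- h * l f)) j a) \<le> B * exp (h * awalk_cost l (p @ [a]))"
proof -
  let ?w = "\<lambda>q. exp (- h * awalk_cost l q)"
  let ?E = "\<lambda>j. (\<lambda>q. p @ a # q) ` extensions j a"
  have a: "a \<in> arcs G" using path_verts_arcs[OF pa] by simp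
  have len: "q \<in> path_verts v \<and> length q = Suc (length p + j)" if "q \<in> ?E j" for q j
    using that extensions_path_verts[OF pa] by auto
  have disj: "?E i \<inter> ?E j = {}" if "i \<noteq> j" for i j
  proof (rule equals0I)
    fix q assume "q \<in> ?E i \<inter> ?E j"
    then have "Suc (length p + i) = Suc (length p + j)" using len[of q i] len[of q j] by simp
    then show False using that by simp
  qed
  have "(\<Sum>j<J. ?w (p @ [a]) * continuation_sum (\<lambda>f. exp (- h * l f)) j a) =
      (\<Sum>j<J. \<Sum>q\<in>extensions j a. ?w (p @ a # q))"
    unfolding sum_extensions[OF a, symmetric] sum_distrib_left
    by (intro sum.cong refl) (simp add: exp_add[symmetric] algebra_simps)
  also have "\<dots> = (\<Sum>j<J. \<Sum>q\<in>?E j. ?w q)"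
    by (simp add: sum.reindex inj_on_def)
  also have "\<dots> = (\<Sum>q\<in>(\<Union>j<J. ?E j). ?w q)"
    using finite_extensions[OF a] disj by (intro sum.UNION_disjoint[symmetric]) auto
  also have "\<dots> \<le> B"
    using finite_extensions[OF a] extensions_path_verts[OF pa] by (intro bound) auto
  finally have "?w (p @ [a]) * (\<Sum>j<J. continuation_sum (\<lambda>f. exp (- h * l f)) j a) \<le> B"
    by (simp add: sum_distrib_left)
  then have "exp (h * awalk_cost l (p @ [a])) * (?w (p @ [a]) * (\<Sum>j<J. continuation_sum (\<lambda>f. exp (- h * l f)) j a))
      \<le> exp (h * awalk_cost l (p @ [a])) * B"
    by (intro mult_left_mono) auto
  then show ?thesis by (simp add: mult.assoc[symmetric] exp_add[symmetric] mult.commute)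
qed

text \<open>
  Applying the transfer operator shifts the series by one index and so removes its first
  term, which is 1.
\<close>

lemma subinvariant_of_bounded_sums:
  assumes "\<And>e. e \<in> arcs G \<Longrightarrow> \<exists>B. \<forall>J. (\<Sum>j<J. continuation_sum (\<lambda>f. exp (- h * l f)) j e) \<le> B"
  shows "subinvariant h l (\<lambda>e. \<Sum>j. continuation_sum (\<lambda>f. exp (- h * l f)) j e)"
proof -
  define s where "s = continuation_sum (\<lambda>f. exp (- h * l f))"
  have nonneg: "0 \<le> s j e" for j e unfolding s_def by (rule continuation_sum_nonneg) simp
  have summable: "summable (\<lambda>j. s j e)" if "e \<in> arcs G" for e
    using assms[OF that] nonneg by (auto simp: s_def intro: summableI_nonneg_bounded)
  have "0 < (\<Sum>j. s j e) \<and> (\<Sum>f\<in>continuations e. exp (- h * l f) * (\<Sum>j. s j f)) \<le> (\<Sum>j. s j e)"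
    if e: "e \<in> arcs G" for e
  proof -
    have sf: "summable (\<lambda>j. s j f)" if "f \<in> continuations e" for f
      using that summable by (simp add: continuations_iff)
    have "(\<Sum>f\<in>continuations e. exp (- h * l f) * (\<Sum>j. s j f)) =
        (\<Sum>f\<in>continuations e. \<Sum>j. exp (- h * l f) * s j f)"
      using sf by (intro sum.cong refl suminf_mult[symmetric])
    also have "\<dots> = (\<Sum>j. \<Sum>f\<in>continuations e. exp (- h * l f) * s j f)"
      using sf by (intro suminf_sum[symmetric] summable_mult)
    also have "\<dots> = (\<Sum>j. s (Suc j) e)" by (simp add: s_def)
    also have "\<dots> = (\<Sum>j. s j e) - 1" using suminf_split_head[OF summable[OF e]] by (simp add: s_def)
    finally have eq: "(\<Sum>f\<in>continuations e. exp (- h * l f) * (\<Sum>j. s j f)) = (\<Sum>j. s j e) - 1" .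
    moreover have "0 \<le> (\<Sum>f\<in>continuations e. exp (- h * l f) * (\<Sum>j. s j f))"
      using sf nonneg by (intro sum_nonneg mult_nonneg_nonneg suminf_nonneg) auto
    ultimately show ?thesis by simp
  qed
  then show ?thesis by (simp add: subinvariant_def s_def)
qed

end

section \<open>Volume entropy of a regular graph\<close>

locale universally_covered_regular_graph = X: regular_graph X xrev k
  for X :: "('a, 'b) pre_digraph" and xrev k +
  fixes T :: "('c, 'd) pre_digraph" and trev pV pE
  assumes finite_arcs: "finite (arcs X)"
    and connected: "connected X"
    and cover: "universal_covering_tree T trev X xrev pV pE"
begin

lemma bij_out_arcs: "v \<in> verts T \<Longrightarrow> bij_betw pE (out_arcs T v) (out_arcs X (pV v))"
  and pV_in_verts: "v \<in> verts T \<Longrightarrow> pV v \<in> verts X"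
  and pE_in_arcs: "a \<in> arcs T \<Longrightarrow> pE a \<in> arcs X"
  and head_pE: "a \<in> arcs T \<Longrightarrow> head X (pE a) = pV (head T a)"
  and pE_trev: "a \<in> arcs T \<Longrightarrow> pE (trev a) = xrev (pE a)"
  and acyclic: "pre_digraph.cycle T p \<Longrightarrow> \<exists>e. p = [e, trev e]"
  using cover
  by (auto simp: universal_covering_tree_def bidirected_tree_def graph_covering_def)

sublocale T: regular_graph T trev k
proof -
  interpret T: bidirected_digraph T trev
    using cover by (simp add: universal_covering_tree_def bidirected_tree_def)
  show "regular_graph T trev k"
  proof unfold_locales
    show "k > 1" by (rule X.k_gt_1)
    fix v assume "v \<in> verts T"
    then show "out_degree T v = k + 1"
      using bij_betw_same_card[OF bij_out_arcs] X.card_out_arcs pV_in_verts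
      by (simp add: out_degree_def)
  qed
qed

lemma bij_continuations:
  assumes a: "a \<in> arcs T"
  shows "bij_betw pE (T.continuations a) (X.continuations (pE a))"
proof -
  have "bij_betw pE (out_arcs T (head T a)) (out_arcs X (head X (pE a)))"
    using bij_out_arcs[of "head T a"] a head_pE by simp
  moreover have "bij_betw pE {trev a} {xrev (pE a)}" using pE_trev[OF a] by simp
  ultimately show ?thesis
    unfolding T.continuations_eq_out_arcs X.continuations_eq_out_arcs
    using a pE_in_arcs by (intro bij_betw_DiffI) auto
qed

lemma continuation_sum_lift:
  "a \<in> arcs T \<Longrightarrow> T.continuation_sum (\<lambda>b. c (pE b)) j a = X.continuation_sum c j (pE a)"
proof (induction j arbitrary: a)
  case (Suc j)
  have "T.continuation_sum (\<lambda>b. c (pE b)) (Suc j) a =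
      (\<Sum>b\<in>T.continuations a. c (pE b) * X.continuation_sum c j (pE b))"
    by (simp add: Suc.IH T.continuations_iff)
  also have "\<dots> = (\<Sum>f\<in>X.continuations (pE a). c f * X.continuation_sum c j f)"
    by (rule sum.reindex_bij_betw[OF bij_continuations[OF Suc.prems]])
  finally show ?case by simp
qed simp

text \<open>
  The projections of the last arcs of reduced walks form a forward closed set of arcs, because
  the covering maps the continuations of an arc onto those of its image.
\<close>

lemma every_arc_ends_reduced_walk:
  assumes x: "x \<in> verts T" and e: "e \<in> arcs X"
  shows "\<exists>p a. p @ [a] \<in> T.path_verts x \<and> pE a = e"
proof -
  define R where "R = {pE a | p a. p @ [a] \<in> T.path_verts x}"
  have arcs: "a \<in> arcs T" if "p @ [a] \<in> T.path_verts x" for p a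
    using T.path_verts_arcs[OF that] by simp
  have "R = arcs X"
  proof (rule X.forward_closed_eq_arcs[OF finite_arcs connected])
    show "R \<subseteq> arcs X" using arcs pE_in_arcs by (auto simp: R_def)
    have "out_arcs T x \<noteq> {}" using T.card_out_arcs[OF x] by force
    then obtain a where "a \<in> out_arcs T x" by blast
    then have "a \<in> arcs T" "tail T a = x" by simp_all
    then have "[] @ [a] \<in> T.path_verts x"
      using T.Nil_in_path_verts[OF x] unfolding T.path_verts_snoc by (simp add: T.path_end_def)
    then show "R \<noteq> {}" unfolding R_def by blast
    show "X.continuations e \<subseteq> R" if eR: "e \<in> R" for e
    proof
      fix f assume f: "f \<in> X.continuations e"
      obtain p a where pa: "p @ [a] \<in> T.path_verts x" "e = pE a" using eR by (auto simp: R_def)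
      then obtain b where "b \<in> T.continuations a" "f = pE b"
        using bij_continuations[OF arcs[OF pa(1)]] f by (auto simp: bij_betw_def)
      then have "(p @ [a]) @ [b] \<in> T.path_verts x" using T.path_verts_snoc_continuation[OF pa(1)] by simp
      then show "f \<in> R" unfolding R_def using \<open>f = pE b\<close> by blast
    qed
  qed
  with e have "e \<in> R" by blast
  then show ?thesis unfolding R_def by blast
qed

lemma ball_length_nonneg: "0 \<le> ball_length T l x r"
  by (auto simp: ball_length_def intro!: infsum_nonneg)

text \<open>
  For \<open>h'\<close> between the entropy and \<open>h\<close>, balls of large radius \<open>r\<close> have volume at most
  \<open>exp (h' \<cdot> r)\<close>, and this bounds the number of reduced walks of length less than \<open>r\<close>.
\<close>

lemma subinvariant_of_entropy_less:
  assumes x: "x \<in> verts T" and l: "l \<in> edge_lengths X xrev" and h: "0 < h"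
    and less: "volume_entropy T pE x l < ereal h"
  shows "\<exists>u. X.subinvariant h l u"
proof -
  define L where "L = l \<circ> pE"
  \<comment> \<open>The extra element 1 only makes the set nonempty.\<close>
  define m where "m = Min (insert 1 (l ` arcs X))"
  have m: "m > 0" using finite_arcs l by (auto simp: m_def edge_lengths_def)
  have mL: "m \<le> L e" if "e \<in> arcs T" for e
    unfolding m_def L_def using finite_arcs pE_in_arcs[OF that] by (intro Min_le) auto
  have "max 0 (volume_entropy T pE x l) < ereal h" using h less by simp
  then obtain h' where h': "max 0 (volume_entropy T pE x l) < ereal h'" "ereal h' < ereal h"
    using ereal_dense2 by blast
  then have h'0: "0 < h'" "volume_entropy T pE x l < ereal h'" "h' < h" by simp_all
  from Limsup_lessD[OF h'0(2)[unfolded volume_entropy_def]]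
  obtain r0 where r0: "\<And>r. r \<ge> r0 \<Longrightarrow> 1 / r * ln (ball_length T L x r) < h'"
    by (auto simp: eventually_at_top_linorder L_def)
  \<comment> \<open>Radii below \<open>s\<close> are handled by enlarging the ball to radius \<open>s\<close>, at the cost of the factor \<open>exp (h' * s)\<close>.\<close>
  define s where "s = max r0 1"
  have ball: "ball_length T L x r \<le> exp (h' * r)" if r: "r \<ge> s" for r
  proof (cases "ball_length T L x r > 0")
    case True
    have "ln (ball_length T L x r) < h' * r" using r0[of r] r by (auto simp: s_def field_simps)
    then have "exp (ln (ball_length T L x r)) \<le> exp (h' * r)" by simp
    then show ?thesis using True by simp
  next
    case False
    then show ?thesis using exp_gt_zero[of "h' * r"] by linarith
  qed
  let ?Q = "T.path_verts x - {[]}"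
  have "\<exists>B. \<forall>F. finite F \<longrightarrow> F \<subseteq> ?Q \<longrightarrow> (\<Sum>q\<in>F. exp (- h * T.awalk_cost L q)) \<le> B"
  proof (rule sum_exp_bounded_of_growth)
    fix F r assume F: "finite F" "F \<subseteq> ?Q" "\<And>q. q \<in> F \<Longrightarrow> T.awalk_cost L q < r" "(r::real) \<ge> 0"
    have "real (card F) * m / 2 \<le> ball_length T L x (max r s)"
    proof (rule T.ball_length_lower[OF acyclic mL m])
      show "0 \<le> max r s" using F(4) by simp
      show "T.awalk_cost L p < max r s" if "p \<in> F" for p using F(3)[OF that] by simp
    qed (use F in auto)
    also have "\<dots> \<le> exp (h' * max r s)" by (rule ball) simp
    also have "\<dots> \<le> exp (h' * (s + r))"
      using h'0 F(4) by (simp add: s_def)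
    finally show "real (card F) \<le> (2 / m * exp (h' * s)) * exp (h' * r)"
      using m by (simp add: field_simps exp_add)
  next
    fix q assume "q \<in> ?Q"
    then have "m * real (length q) \<le> T.awalk_cost L q"
      using T.path_verts_arcs by (intro T.length_le_awalk_cost mL) auto
    moreover have "0 \<le> m * real (length q)" using m by simp
    ultimately show "0 \<le> T.awalk_cost L q" by linarith
  qed (use h h'0 in auto)
  then obtain B where B: "\<And>F. finite F \<Longrightarrow> F \<subseteq> ?Q \<Longrightarrow> (\<Sum>q\<in>F. exp (- h * T.awalk_cost L q)) \<le> B"
    by blast
  have "\<exists>C. \<forall>J. (\<Sum>j<J. X.continuation_sum (\<lambda>f. exp (- h * l f)) j e) \<le> C" if e: "e \<in> arcs X" for e
  proof -
    obtain p a where pa: "p @ [a] \<in> T.path_verts x" "pE a = e"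
      using every_arc_ends_reduced_walk[OF x e] by blast
    have a: "a \<in> arcs T" using T.path_verts_arcs[OF pa(1)] by simp
    have "T.continuation_sum (\<lambda>f. exp (- h * L f)) j a = X.continuation_sum (\<lambda>f. exp (- h * l f)) j e" for j
      using continuation_sum_lift[OF a, of "\<lambda>f. exp (- h * l f)" j] pa(2) by (simp add: L_def)
    with T.sum_continuation_sum_bounded[OF B pa(1)] show ?thesis by auto
  qed
  from X.subinvariant_of_bounded_sums[OF this] show ?thesis by blast
qed

lemma entropy_le_of_equal_lengths:
  assumes l: "\<And>e. e \<in> arcs X \<Longrightarrow> l e = m" and m: "m > 0"
  shows "volume_entropy T pE x l \<le> ereal (ln (real k) / m)"
proof -
  \<comment> \<open>The summand 1 ensures \<open>ln C \<ge> 0\<close>, which covers balls of volume 0, where \<open>ln 0 = 0\<close>.\<close>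
  define C where "C = 2 * (real k + 1)^2 * m + 1"
  have C: "C \<ge> 1" using m by (simp add: C_def)
  have bound: "1 / r * ln (ball_length T (l \<circ> pE) x r) \<le> ln C / r + ln (real k) / m" if r: "r \<ge> 1" for r
  proof -
    let ?b = "ball_length T (l \<circ> pE) x r" and ?e = "ln (real k) / m * r"
    have lm: "(l \<circ> pE) e = m" if "e \<in> arcs T" for e using l pE_in_arcs that by simp
    have "?b \<le> 2 * (real k + 1)^2 * m * exp ?e"
      using r m by (intro T.ball_length_upper) (auto simp: lm simp del: comp_apply)
    also have "\<dots> \<le> C * exp ?e" by (intro mult_right_mono) (auto simp: C_def)
    finally have b: "?b \<le> C * exp ?e" .
    have "0 \<le> ?e" using m r X.k_gt_1 by simp
    have "ln ?b \<le> ln C + ?e"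
    proof (cases "?b = 0")
      case True
      then show ?thesis using C \<open>0 \<le> ?e\<close> by simp
    next
      case False
      then have "0 < ?b" using ball_length_nonneg by (simp add: order_less_le)
      then have "ln ?b \<le> ln (C * exp ?e)" using b by simp
      also have "\<dots> = ln C + ?e" using C by (simp add: ln_mult)
      finally show ?thesis .
    qed
    then have "1 / r * ln ?b \<le> 1 / r * (ln C + ?e)" using r by (intro mult_left_mono) auto
    then show ?thesis using r by (simp add: field_simps)
  qed
  have "volume_entropy T pE x l \<le> Limsup at_top (\<lambda>r. ereal (ln C / r + ln (real k) / m))"
    unfolding volume_entropy_def
    by (intro Limsup_mono eventually_mono[OF eventually_ge_at_top[of 1]])
      (simp only: bound ereal_less_eq)
  also have "\<dots> = ereal (0 + ln (real k) / m)"
  proof (rule lim_imp_Limsup)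
    have "((\<lambda>r. ln C / r) \<longlongrightarrow> 0) at_top"
      by (intro real_tendsto_divide_at_top[OF tendsto_const] filterlim_ident)
    then show "((\<lambda>r. ereal (ln C / r + ln (real k) / m)) \<longlongrightarrow> ereal (0 + ln (real k) / m)) at_top"
      by (intro tendsto_intros)
  qed simp
  finally show ?thesis by simp
qed

lemma entropy_ge:
  assumes x: "x \<in> verts T" and l: "l \<in> normalized_lengths X xrev"
  shows "ereal (real (card (arcs X)) / 2 * ln (real k)) \<le> volume_entropy T pE x l"
proof (rule ccontr)
  let ?H = "real (card (arcs X)) / 2 * ln (real k)"
  assume "\<not> ?thesis"
  then have less: "volume_entropy T pE x l < ereal ?H" by simp
  have sum2: "(\<Sum>e\<in>arcs X. l e) = 2" and len: "l \<in> edge_lengths X xrev"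
    using l by (auto simp: normalized_lengths_def volume_def)
  have "arcs X \<noteq> {}" using sum2 by auto
  then have "0 < ?H" using finite_arcs X.k_gt_1 by (simp add: card_gt_0_iff)
  with less have "max 0 (volume_entropy T pE x l) < ereal ?H" by simp
  then obtain h where h: "max 0 (volume_entropy T pE x l) < ereal h" "ereal h < ereal ?H"
    using ereal_dense2 by blast
  then have "0 < h" "volume_entropy T pE x l < ereal h" by simp_all
  then obtain u where "X.subinvariant h l u" using subinvariant_of_entropy_less[OF x len] by blast
  from X.entropy_lower_bound[OF finite_arcs this sum2] h show False by simp
qed

text \<open>
  Every \<open>h\<close> above the minimal value exceeds the entropy of \<open>l\<close>, so it has subinvariant weights.
\<close>

lemma lengths_equal_of_entropy_le:
  assumes x: "x \<in> verts T" and l: "l \<in> normalized_lengths X xrev"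
    and le: "volume_entropy T pE x l \<le> ereal (real (card (arcs X)) / 2 * ln (real k))"
    and e: "e \<in> arcs X"
  shows "l e = 2 / real (card (arcs X))"
proof (rule X.lengths_determined_at_minimum[OF finite_arcs _ _ _ e])
  show "(\<Sum>e\<in>arcs X. l e) = 2" using l by (simp add: normalized_lengths_def volume_def)
  show "l (xrev e) = l e" if "e \<in> arcs X" for e
    using l that by (simp add: normalized_lengths_def edge_lengths_def)
  fix h assume h: "real (card (arcs X)) / 2 * ln (real k) < h"
  have "0 \<le> real (card (arcs X)) / 2 * ln (real k)" using X.k_gt_1 by simp
  then have "0 < h" using h by linarith
  moreover have "volume_entropy T pE x l < ereal h" using h by (intro le_less_trans[OF le]) simp
  ultimately show "\<exists>u. X.subinvariant h l u"
    using subinvariant_of_entropy_less[OF x] l by (simp add: normalized_lengths_def)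
qed

lemma entropy_eq_of_equal_lengths:
  assumes x: "x \<in> verts T" and l: "l \<in> normalized_lengths X xrev"
    and eq: "\<And>e. e \<in> arcs X \<Longrightarrow> l e = 2 / real (card (arcs X))"
  shows "volume_entropy T pE x l = ereal (real (card (arcs X)) / 2 * ln (real k))"
proof (rule antisym)
  have "arcs X \<noteq> {}" using l by (auto simp: normalized_lengths_def volume_def)
  then have "2 / real (card (arcs X)) > 0" using finite_arcs by (simp add: card_gt_0_iff)
  from entropy_le_of_equal_lengths[OF eq this, where x = x]
  show "volume_entropy T pE x l \<le> ereal (real (card (arcs X)) / 2 * ln (real k))"
    by (simp add: mult.commute)
qed (rule entropy_ge[OF x l])

end

theorem corollary7:
  fixes X :: "('a, 'b) pre_digraph" and xrev :: "'b \<Rightarrow> 'b"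
    and T :: "('c, 'd) pre_digraph" and trev :: "'d \<Rightarrow> 'd"
    and pV :: "'c \<Rightarrow> 'a" and pE :: "'d \<Rightarrow> 'b"
    and x\<^sub>0 :: 'c and k :: nat
  assumes "bidirected_digraph X xrev" and "fin_digraph X" and "connected X"
    and "k > 1" and "\<forall>v\<in>verts X. out_degree X v = k + 1"
    and "universal_covering_tree T trev X xrev pV pE" and "x\<^sub>0 \<in> verts T"
  defines "minimal \<equiv> is_arg_min (volume_entropy T pE x\<^sub>0) (\<lambda>l. l \<in> normalized_lengths X xrev)"
  shows "(\<forall>l\<in>normalized_lengths X xrev. minimal l \<longleftrightarrow> (\<forall>e\<in>arcs X. \<forall>e'\<in>arcs X. l e = l e')) \<and>
    (\<exists>l. minimal l) \<and>
    (\<forall>l. minimal l \<longrightarrow>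
      volume_entropy T pE x\<^sub>0 l = ereal (real (card (arcs X)) / 2 * ln (real k)))"
proof -
  interpret universally_covered_regular_graph X xrev k T trev pV pE
  proof (intro universally_covered_regular_graph.intro regular_graph.intro
      regular_graph_axioms.intro universally_covered_regular_graph_axioms.intro)
    show "finite (arcs X)" using assms(2) by (rule fin_digraph.finite_arcs)
    show "out_degree X v = k + 1" if "v \<in> verts X" for v using assms(5) that by blast
  qed fact+
  let ?n = "real (card (arcs X))"
  let ?H = "ereal (?n / 2 * ln (real k))"
  let ?N = "normalized_lengths X xrev"
  let ?h = "volume_entropy T pE x\<^sub>0"
  note x = assms(7)
  have "out_arcs T x\<^sub>0 \<noteq> {}" using T.card_out_arcs[OF x] by force
  then obtain a where "a \<in> out_arcs T x\<^sub>0" by blast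
  then have "pE a \<in> arcs X" using pE_in_arcs by simp
  then have "card (arcs X) > 0" using finite_arcs card_gt_0_iff by blast
  then have n: "?n > 0" by simp
  have equal: "l e = 2 / ?n" if l: "l \<in> ?N" and eq: "\<forall>e\<in>arcs X. \<forall>e'\<in>arcs X. l e = l e'" and e: "e \<in> arcs X" for l e
  proof -
    have "(\<Sum>e'\<in>arcs X. l e') = (\<Sum>e'\<in>arcs X. l e)" using eq e by (intro sum.cong refl) blast
    then have "?n * l e = 2" using l by (simp add: normalized_lengths_def volume_def)
    then show ?thesis using n by (simp add: field_simps)
  qed
  define c where "c = (\<lambda>e::'b. 2 / ?n)"
  have c: "c \<in> ?N" using n
    by (simp add: c_def normalized_lengths_def edge_lengths_def volume_def)
  have hc: "?h c = ?H" by (rule entropy_eq_of_equal_lengths[OF x c]) (simp add: c_def)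
  have minimal_iff: "minimal l \<longleftrightarrow> l \<in> ?N \<and> ?h l = ?H" for l
  proof
    assume "minimal l"
    then have l: "l \<in> ?N" and "\<not> ?h c < ?h l"
      using c unfolding minimal_def is_arg_min_def by auto
    then show "l \<in> ?N \<and> ?h l = ?H" using entropy_ge[OF x l] unfolding hc by simp
  next
    assume l: "l \<in> ?N \<and> ?h l = ?H"
    then show "minimal l"
      using entropy_ge[OF x] unfolding minimal_def is_arg_min_def by (auto simp: not_less)
  qed
  have "minimal l \<longleftrightarrow> (\<forall>e\<in>arcs X. \<forall>e'\<in>arcs X. l e = l e')" if l: "l \<in> ?N" for l
  proof
    assume "minimal l"
    then have "?h l \<le> ?H" by (simp add: minimal_iff)
    then show "\<forall>e\<in>arcs X. \<forall>e'\<in>arcs X. l e = l e'"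
      using lengths_equal_of_entropy_le[OF x l] by simp
  next
    assume "\<forall>e\<in>arcs X. \<forall>e'\<in>arcs X. l e = l e'"
    from entropy_eq_of_equal_lengths[OF x l equal[OF l this]]
    show "minimal l" by (simp add: minimal_iff l)
  qed
  moreover have "minimal c" using c hc by (simp add: minimal_iff)
  ultimately show ?thesis using minimal_iff by blast
qed

end
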